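(* Every metrically projective Banach space is isometrically isomorphic to $l_1(M)$ for some set $M$.
   Context: Banach spaces are over $\mathbb{C}$. An operator $\tau:Y\to X$ is strictly coisometric if it maps the closed unit ball of $Y$ onto the closed unit ball of $X$. A Banach space $P$ is metrically projective if for every strictly coisometric linear operator $\tau:Y\to X$ between Banach spaces, every bounded linear operator $\varphi:P\to X$ has a lifting of the same norm, i.e. there is a bounded linear operator $\psi:P\to Y$ with $\tau\psi=\varphi$ and $\|\psi\|=\|\varphi\|$. *)

theory Defs
  imports "HOL-Analysis.Analysis" "HOL-Algebra.Module" "HOL-Algebra.Algebraic_Closure_Type"
begin

text \<open>
  Banach spaces are represented by carrier sets rather than by type classes, because metric
  projectivity quantifies over all Banach spaces inside a formula. The fields \<open>mult\<close> and \<open>one\<close>,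
  which the module records of HOL-Algebra inherit from rings, play no role for modules.
\<close>

record 'a normed_module = "(complex, 'a) module" +
  vnorm :: "'a \<Rightarrow> real"

locale complex_normed_space = module "ring_of_type_algebra :: complex ring" E
  for E :: "'a normed_module" (structure) +
  assumes vnorm_nonneg: "x \<in> carrier E \<Longrightarrow> 0 \<le> vnorm E x"
    and vnorm_eq_zero_iff: "x \<in> carrier E \<Longrightarrow> vnorm E x = 0 \<longleftrightarrow> x = \<zero>\<^bsub>E\<^esub>"
    and vnorm_triangle:
      "x \<in> carrier E \<Longrightarrow> y \<in> carrier E \<Longrightarrow> vnorm E (x \<oplus>\<^bsub>E\<^esub> y) \<le> vnorm E x + vnorm E y"
    and vnorm_smult: "x \<in> carrier E \<Longrightarrow> vnorm E (c \<odot>\<^bsub>E\<^esub> x) = cmod c * vnorm E x"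

text \<open>The value off the carrier is immaterial; \<open>0\<close> is chosen because the locale
  \<^locale>\<open>Metric_space\<close> requires nonnegativity and symmetry everywhere.\<close>

definition vdist :: "'a normed_module \<Rightarrow> 'a \<Rightarrow> 'a \<Rightarrow> real" where
  "vdist E x y =
    (if x \<in> carrier E \<and> y \<in> carrier E then vnorm E (x \<ominus>\<^bsub>E\<^esub> y) else 0)"

locale complex_banach_space = complex_normed_space +
  assumes complete: "Metric_space.mcomplete (carrier E) (vdist E)"

definition linear_operator ::
    "'a normed_module \<Rightarrow> 'b normed_module \<Rightarrow> ('a \<Rightarrow> 'b) \<Rightarrow> bool" where
  "linear_operator E F T \<longleftrightarrow>
    T \<in> carrier E \<rightarrow> carrier F \<and>
    (\<forall>x\<in>carrier E. \<forall>y\<in>carrier E. T (x \<oplus>\<^bsub>E\<^esub> y) = T x \<oplus>\<^bsub>F\<^esub> T y) \<and>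
    (\<forall>c. \<forall>x\<in>carrier E. T (c \<odot>\<^bsub>E\<^esub> x) = c \<odot>\<^bsub>F\<^esub> T x)"

definition bounded_operator ::
    "'a normed_module \<Rightarrow> 'b normed_module \<Rightarrow> ('a \<Rightarrow> 'b) \<Rightarrow> bool" where
  "bounded_operator E F T \<longleftrightarrow>
    linear_operator E F T \<and> (\<exists>K. \<forall>x\<in>carrier E. vnorm F (T x) \<le> K * vnorm E x)"

definition closed_unit_ball :: "'a normed_module \<Rightarrow> 'a set" where
  "closed_unit_ball E = {x \<in> carrier E. vnorm E x \<le> 1}"

definition operator_norm ::
    "'a normed_module \<Rightarrow> 'b normed_module \<Rightarrow> ('a \<Rightarrow> 'b) \<Rightarrow> real" where
  "operator_norm E F T = (SUP x\<in>closed_unit_ball E. vnorm F (T x))"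

definition strictly_coisometric ::
    "'a normed_module \<Rightarrow> 'b normed_module \<Rightarrow> ('a \<Rightarrow> 'b) \<Rightarrow> bool" where
  "strictly_coisometric E F \<tau> \<longleftrightarrow>
    linear_operator E F \<tau> \<and> \<tau> ` closed_unit_ball E = closed_unit_ball F"

text \<open>
  HOL cannot quantify over types within a formula, so the lifting property is tested on all Banach
  spaces whose points form a subset of the type \<open>'u\<close>, which acts as a universe. Up to isometric
  isomorphism these are the Banach spaces of cardinality at most that of \<open>'u\<close>, so the
  property becomes stronger as \<open>'u\<close> grows. For \<open>P\<close> with points in \<open>'a\<close>, the
  universe \<open>'a \<Rightarrow> complex\<close> contains copies of \<open>P\<close> and of \<open>l1_space S\<close> for every \<open>S\<close> in \<open>'a\<close>;
  assuming the property only there is weaker than assuming it over all Banach spaces.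
\<close>

definition metrically_projective :: "'u itself \<Rightarrow> 'a normed_module \<Rightarrow> bool" where
  "metrically_projective _ P \<longleftrightarrow>
    complex_banach_space P \<and>
    (\<forall>(F :: 'u normed_module) (E :: 'u normed_module) \<tau> \<phi>.
      complex_banach_space F \<longrightarrow> complex_banach_space E \<longrightarrow>
      strictly_coisometric F E \<tau> \<longrightarrow> bounded_operator P E \<phi> \<longrightarrow>
      (\<exists>\<psi>. bounded_operator P F \<psi> \<and> (\<forall>p\<in>carrier P. \<tau> (\<psi> p) = \<phi> p) \<and>
           operator_norm P F \<psi> = operator_norm P E \<phi>))"

definition isometrically_isomorphic :: "'a normed_module \<Rightarrow> 'b normed_module \<Rightarrow> bool" where
  "isometrically_isomorphic E F \<longleftrightarrow>
    (\<exists>T. linear_operator E F T \<and> bij_betw T (carrier E) (carrier F) \<and>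
         (\<forall>x\<in>carrier E. vnorm F (T x) = vnorm E x))"

text \<open>Functions on \<open>M\<close> are encoded as total functions vanishing off \<open>M\<close>.\<close>

definition l1_space :: "'m set \<Rightarrow> ('m \<Rightarrow> complex) normed_module" where
  "l1_space M =
    \<lparr>carrier = {f. (\<forall>m. m \<notin> M \<longrightarrow> f m = 0) \<and> (\<lambda>m. cmod (f m)) summable_on M},
     monoid.mult = undefined, one = undefined,
     ring.zero = (\<lambda>m. 0), add = (\<lambda>f g m. f m + g m),
     smult = (\<lambda>c f m. c * f m),
     vnorm = (\<lambda>f. \<Sum>\<^sub>\<infinity>m\<in>M. cmod (f m))\<rparr>"

end

theory Submission
  imports Defs
begin

text \<open>
  Let \<open>S\<close> be the closed unit ball of \<open>P\<close>. The map \<open>g \<mapsto> \<Sum>s. g s * s\<close> from \<open>l\<^sub>1(S)\<close> to \<open>P\<close> is strictly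
  coisometric, so the identity of \<open>P\<close> lifts to an isometric section \<open>\<psi>\<close>, and \<open>P\<close> becomes the range
  of the norm one projection of \<open>l\<^sub>1(S)\<close> with matrix entries \<open>f s u = \<psi> s u\<close>. Contractivity forces
  equality in all triangle inequalities, so the moduli \<open>\<bar>f s u\<bar>\<close> form an idempotent matrix, and row
  \<open>u\<close> has norm \<open>1\<close> whenever some \<open>f s u\<close> is nonzero; call such \<open>u\<close> active. By a variance argument,
  rows with indices in the support of an active row have the same moduli as that row. Hence the
  supports of active rows partition the active indices, and rows with the same support are unimodular
  multiples of each other. One row from each class gives a family of disjointly supported unit
  vectors spanning the range, which is therefore \<open>l\<^sub>1(M)\<close> for a set \<open>M\<close> of class representatives.
\<close>

section \<open>Contractive projections on \<open>l\<^sub>1\<close>\<close>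

text \<open>The differences \<open>g i - f i\<close> are nonnegative with sum 0, so each of them
  vanishes. All later equality cases reduce to this comparison of two series with the same
  sum.\<close>

lemma has_sum_le_imp_eq:
  fixes f g :: "'i \<Rightarrow> real"
  assumes "(f has_sum a) A" "(g has_sum a) A" "\<And>i. i \<in> A \<Longrightarrow> f i \<le> g i" "i \<in> A"
  shows "f i = g i"
proof -
  have "((\<lambda>i. g i - f i) has_sum (a - a)) A"
    using has_sum_add[OF assms(2) has_sum_uminusI[OF assms(1)]] by simp
  then have "g i - f i = 0"
    using assms(3,4) by (intro nonneg_has_sum_le_0D[where A=A and a=0 and f="\<lambda>i. g i - f i"]) auto
  then show ?thesis by simp
qed

text \<open>Tonelli for unordered sums: nonnegativity and convergence of the row sums give
  summability over the product, which can then be summed by columns.\<close>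

lemma has_sum_swap_nonneg:
  fixes F :: "'i \<Rightarrow> 'j \<Rightarrow> real"
  assumes nonneg: "\<And>i j. i \<in> A \<Longrightarrow> j \<in> B \<Longrightarrow> 0 \<le> F i j"
    and rows: "\<And>i. i \<in> A \<Longrightarrow> (F i has_sum r i) B"
    and total: "(r has_sum s) A"
  shows "j \<in> B \<Longrightarrow> (\<lambda>i. F i j) summable_on A"
    and "((\<lambda>j. \<Sum>\<^sub>\<infinity>i\<in>A. F i j) has_sum s) B"
proof -
  have summ: "(\<lambda>(i, j). F i j) summable_on A \<times> B"
    by (rule summable_on_SigmaI[where g = r])
      (use rows total nonneg in \<open>auto simp: summable_on_def\<close>)
  have sum1: "((\<lambda>(i, j). F i j) has_sum s) (A \<times> B)"
    by (rule has_sum_SigmaI[where g = r]) (use rows total summ in auto)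
  then have sum2: "((\<lambda>(j, i). F i j) has_sum s) (B \<times> A)"
    by (subst (asm) has_sum_swap) (simp add: case_prod_unfold)
  show cols: "(\<lambda>i. F i j) summable_on A" if "j \<in> B" for j
    using summable_on_SigmaD1[where f = "\<lambda>j i. F i j" and A = B and B = "\<lambda>_. A" and x = j]
      sum2 that by (auto simp: summable_on_def)
  show "((\<lambda>j. \<Sum>\<^sub>\<infinity>i\<in>A. F i j) has_sum s) B"
    by (rule has_sum_SigmaD[OF sum2]) (use cols in auto)
qed

text \<open>Rotation by \<open>cnj (sgn w)\<close> turns the sum into \<open>cmod w\<close>. The
  real parts of the rotated terms are bounded by the moduli and have the same sum, so every rotated
  term is real and nonnegative.\<close>

lemma has_sum_triangle_eq:
  fixes z :: "'i \<Rightarrow> complex" and w :: complex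
  assumes z: "(z has_sum w) A" and norm_z: "((\<lambda>i. cmod (z i)) has_sum cmod w) A" and "i \<in> A"
  shows "z i = cmod (z i) * sgn w"
proof (cases "w = 0")
  case True
  then have "cmod (z i) = 0"
    using norm_z \<open>i \<in> A\<close> by (intro nonneg_has_sum_le_0D[where A=A and a=0 and f="\<lambda>i. cmod (z i)"]) auto
  then show ?thesis by simp
next
  case False
  have sgn1: "sgn w * cnj (sgn w) = 1"
    using False by (simp add: complex_norm_square[symmetric] norm_sgn)
  have "w * cnj (sgn w) = cmod w * (sgn w * cnj (sgn w))"
    using False by (simp add: sgn_eq field_simps)
  then have "Re (w * cnj (sgn w)) = cmod w"
    using sgn1 by simp
  then have "((\<lambda>i. Re (z i * cnj (sgn w))) has_sum cmod w) A"
    using has_sum_Re[OF has_sum_cmult_left[OF z, of "cnj (sgn w)"]] by simp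
  moreover have "Re (z j * cnj (sgn w)) \<le> cmod (z j)" for j
    using complex_Re_le_cmod[of "z j * cnj (sgn w)"] False by (simp add: norm_mult norm_sgn)
  ultimately have "Re (z i * cnj (sgn w)) = cmod (z i)"
    using has_sum_le_imp_eq[OF _ norm_z] \<open>i \<in> A\<close> by blast
  moreover have "cmod (z i * cnj (sgn w)) = cmod (z i)"
    using False by (simp add: norm_mult norm_sgn)
  \<comment> \<open>A real part equal to the modulus forces the imaginary part to be 0.\<close>
  ultimately have "z i * cnj (sgn w) = cmod (z i)"
    by (metis Re_complex_of_real cmod_eq_Re complex_eq_iff norm_complex_def
        Im_complex_of_real cmod_power2 add_cancel_left_right power2_eq_square zero_eq_power2)
  then have "z i * (sgn w * cnj (sgn w)) = cmod (z i) * sgn w"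
    by (simp add: mult_ac)
  then show ?thesis using sgn1 by simp
qed

text \<open>
  For fixed \<open>u\<close>, the function \<open>h v = R v u\<close> satisfies \<open>h w = \<Sum>v. R w v * h v\<close>, so
  \<open>q w - (h w)\<^sup>2\<close> below is the variance of \<open>h\<close> under the distribution \<open>R w\<close>. Since row \<open>s\<close> is an
  invariant distribution, these variances average to \<open>0\<close> under it and hence vanish.
\<close>

lemma stochastic_idempotent_const:
  fixes R :: "'a \<Rightarrow> 'a \<Rightarrow> real"
  assumes nonneg: "\<And>s v. s \<in> S \<Longrightarrow> v \<in> S \<Longrightarrow> 0 \<le> R s v"
    and le1: "\<And>s v. s \<in> S \<Longrightarrow> v \<in> S \<Longrightarrow> R s v \<le> 1"
    and idem: "\<And>s u. s \<in> S \<Longrightarrow> u \<in> S \<Longrightarrow> ((\<lambda>v. R s v * R v u) has_sum R s u) S"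
    and summ: "\<And>s. s \<in> S \<Longrightarrow> R s summable_on S"
    and stoch: "\<And>s v. s \<in> S \<Longrightarrow> v \<in> S \<Longrightarrow> R s v \<noteq> 0 \<Longrightarrow> (R v has_sum 1) S"
    and S: "s \<in> S" "w \<in> S" "v \<in> S" "u \<in> S"
    and nz: "R s w \<noteq> 0" "R w v \<noteq> 0"
  shows "R v u = R w u"
proof -
  define h where "h v = R v u" for v
  have h01: "0 \<le> h v" "h v \<le> 1" "0 \<le> (h v)\<^sup>2" "(h v)\<^sup>2 \<le> 1" if "v \<in> S" for v
    using nonneg le1 that \<open>u \<in> S\<close> by (auto simp: h_def power_le_one)
  have h: "((\<lambda>v. R w v * h v) has_sum h w) S" if "w \<in> S" for w
    using idem[OF that \<open>u \<in> S\<close>] by (simp add: h_def)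
  have sq: "(\<lambda>v. R w v * (h v)\<^sup>2) summable_on S" if "w \<in> S" for w
    by (rule summable_on_comparison_test[OF summ[OF that]])
      (use nonneg h01 that in \<open>auto intro: mult_left_le\<close>)
  define q where "q w = (\<Sum>\<^sub>\<infinity>v\<in>S. R w v * (h v)\<^sup>2)" for w
  have q: "((\<lambda>v. R w v * (h v)\<^sup>2) has_sum q w) S" if "w \<in> S" for w
    using sq[OF that] by (simp add: q_def)
  have var: "((\<lambda>v. R w v * (h v - h w)\<^sup>2) has_sum (q w - (h w)\<^sup>2)) S"
    if "w \<in> S" "R s w \<noteq> 0" for w
  proof -
    \<comment> \<open>The square is expanded; the last term uses that row \<open>w\<close> sums to
      1, which \<open>stoch\<close> grants because \<open>R s w\<close> is nonzero.\<close>
    have "((\<lambda>v. R w v * (h v)\<^sup>2 + (-2 * h w) * (R w v * h v) + (h w)\<^sup>2 * R w v)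
        has_sum (q w + (-2 * h w) * h w + (h w)\<^sup>2 * 1)) S"
      by (intro has_sum_add has_sum_cmult_right q h that stoch[OF \<open>s \<in> S\<close>])
    then show ?thesis
      by (simp add: power2_eq_square algebra_simps)
  qed
  \<comment> \<open>After interchanging the sums over \<open>w\<close> and \<open>v\<close>,
    idempotence collapses the sum over \<open>w\<close>: averaging \<open>q\<close> over row
    \<open>s\<close> reproduces \<open>q s\<close>.\<close>
  have swapped: "((\<lambda>w. R s w * q w) has_sum q s) S"
  proof -
    have row: "((\<lambda>w. R s w * R w v * (h v)\<^sup>2) has_sum (R s v * (h v)\<^sup>2)) S" if "v \<in> S" for v
      using has_sum_cmult_left[OF idem[OF \<open>s \<in> S\<close> that]] by simp
    have "((\<lambda>w. \<Sum>\<^sub>\<infinity>v\<in>S. R s w * R w v * (h v)\<^sup>2) has_sum q s) S"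
      by (rule has_sum_swap_nonneg(2)[OF _ row q]) (use nonneg \<open>s \<in> S\<close> in auto)
    also have "?this \<longleftrightarrow> ?thesis"
      by (intro has_sum_cong) (simp add: q_def infsum_cmult_right' mult.assoc)
    finally show ?thesis .
  qed
  have "((\<lambda>w. R s w * (h w)\<^sup>2) has_sum q s) S"
    by (rule q[OF \<open>s \<in> S\<close>])
  \<comment> \<open>Both sides have the sum \<open>q s\<close> over \<open>w\<close>, and
    nonnegativity of the variances orders them termwise.\<close>
  then have "R s w * (h w)\<^sup>2 = R s w * q w"
  proof (rule has_sum_le_imp_eq[OF _ swapped _ \<open>w \<in> S\<close>])
    fix w assume "w \<in> S"
    show "R s w * (h w)\<^sup>2 \<le> R s w * q w"
    proof (cases "R s w = 0")
      case False
      have "0 \<le> q w - (h w)\<^sup>2"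
        by (rule has_sum_nonneg[OF var]) (use False \<open>w \<in> S\<close> nonneg in auto)
      then show ?thesis
        using nonneg \<open>w \<in> S\<close> \<open>s \<in> S\<close> by (simp add: mult_left_mono)
    qed simp
  qed
  then have "q w - (h w)\<^sup>2 \<le> 0"
    using nz by simp
  then have "R w v * (h v - h w)\<^sup>2 = 0"
    by (rule nonneg_has_sum_le_0D[OF var[OF \<open>w \<in> S\<close> nz(1)]]) (use nonneg S in auto)
  then show ?thesis
    using nz by (simp add: h_def)
qed

section \<open>The moduli of a contractive idempotent matrix\<close>

text \<open>The operator of l1(S) is multiplication of row vectors by the matrix \<open>f\<close>
  from the right, so \<open>f s\<close> is the image of the unit vector at \<open>s\<close>. The
  last two assumptions make this operator a contraction and a projection.\<close>

locale contractive_projection =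
  fixes S :: "'a set" and f :: "'a \<Rightarrow> 'a \<Rightarrow> complex"
  assumes summable: "s \<in> S \<Longrightarrow> (\<lambda>u. cmod (f s u)) summable_on S"
    and contractive: "s \<in> S \<Longrightarrow> (\<Sum>\<^sub>\<infinity>u\<in>S. cmod (f s u)) \<le> 1"
    and idempotent: "s \<in> S \<Longrightarrow> u \<in> S \<Longrightarrow> ((\<lambda>v. f s v * f v u) has_sum f s u) S"
begin

text \<open>The range of a projection is its set of fixed points, so no preimage has to be
  mentioned.\<close>

definition in_range :: "('a \<Rightarrow> complex) \<Rightarrow> bool" where
  "in_range g \<longleftrightarrow> (\<lambda>u. cmod (g u)) summable_on S \<and>
     (\<forall>u\<in>S. ((\<lambda>v. g v * f v u) has_sum g u) S)"

lemma in_range_row: "s \<in> S \<Longrightarrow> in_range (f s)"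
  by (simp add: in_range_def summable idempotent)

text \<open>Let \<open>a\<close> be the norm of \<open>g\<close>, let \<open>N v\<close> be the norm
  of row \<open>v\<close>, let \<open>b\<close> be the sum of \<open>cmod (g v) * N v\<close>, and
  let \<open>h\<close> be the image of the moduli of \<open>g\<close> under the matrix of moduli.
  Then \<open>b \<le> a\<close> because \<open>N v \<le> 1\<close>, and \<open>a \<le> b\<close>
  because \<open>cmod (g u) \<le> h u\<close> while \<open>h\<close> sums to \<open>b\<close> by
  interchange. Hence both termwise inequalities are equalities.\<close>

lemma
  assumes "in_range g"
  shows row_norm_eq_1: "v \<in> S \<Longrightarrow> g v \<noteq> 0 \<Longrightarrow> ((\<lambda>u. cmod (f v u)) has_sum 1) S"
    and modulus_fixed: "u \<in> S \<Longrightarrow> ((\<lambda>v. cmod (g v) * cmod (f v u)) has_sum cmod (g u)) S"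
proof -
  define N where "N v = (\<Sum>\<^sub>\<infinity>u\<in>S. cmod (f v u))" for v
  have N: "((\<lambda>u. cmod (f v u)) has_sum N v) S" if "v \<in> S" for v
    using summable[OF that] by (simp add: N_def)
  have N01: "0 \<le> N v" "N v \<le> 1" if "v \<in> S" for v
    using contractive[OF that] by (auto simp: N_def intro: infsum_nonneg)
  define a where "a = (\<Sum>\<^sub>\<infinity>u\<in>S. cmod (g u))"
  have a: "((\<lambda>u. cmod (g u)) has_sum a) S"
    using assms by (simp add: a_def in_range_def)
  have "(\<lambda>v. cmod (g v) * N v) summable_on S"
    by (rule summable_on_comparison_test[OF has_sum_imp_summable[OF a]])
      (use N01 in \<open>auto intro: mult_left_le\<close>)
  then obtain b where b: "((\<lambda>v. cmod (g v) * N v) has_sum b) S"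
    by (auto simp: summable_on_def)
  define h where "h u = (\<Sum>\<^sub>\<infinity>v\<in>S. cmod (g v) * cmod (f v u))" for u
  have rows: "((\<lambda>u. cmod (g v) * cmod (f v u)) has_sum (cmod (g v) * N v)) S" if "v \<in> S" for v
    by (rule has_sum_cmult_right[OF N[OF that]])
  have h: "((\<lambda>v. cmod (g v) * cmod (f v u)) has_sum h u) S" if "u \<in> S" for u
  proof -
    have "(\<lambda>v. cmod (g v) * cmod (f v u)) summable_on S"
      by (rule has_sum_swap_nonneg(1)[OF _ rows b that]) auto
    then show ?thesis by (simp add: h_def)
  qed
  have hb: "(h has_sum b) S"
    unfolding h_def by (rule has_sum_swap_nonneg(2)[OF _ rows b]) auto
  have le_h: "cmod (g u) \<le> h u" if "u \<in> S" for u
  proof (rule norm_has_sum_bound)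
    show "((\<lambda>v. g v * f v u) has_sum g u) S"
      using assms that by (simp add: in_range_def)
    show "((\<lambda>v. norm (g v * f v u)) has_sum h u) S"
      using h[OF that] by (simp add: norm_mult)
  qed
  have "b \<le> a"
    by (rule has_sum_mono[OF b a]) (use N01 in \<open>auto intro: mult_left_le\<close>)
  moreover have "a \<le> b"
    by (rule has_sum_mono[OF a hb le_h])
  ultimately have "a = b" by simp
  show "((\<lambda>v. cmod (g v) * cmod (f v u)) has_sum cmod (g u)) S" if "u \<in> S" for u
    using has_sum_le_imp_eq[OF a hb[folded \<open>a = b\<close>] le_h that] h[OF that] by simp
  show "((\<lambda>u. cmod (f v u)) has_sum 1) S" if "v \<in> S" "g v \<noteq> 0" for v
  proof -
    have "cmod (g v) * N v = cmod (g v)"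
      by (rule has_sum_le_imp_eq[OF b[folded \<open>a = b\<close>] a _ \<open>v \<in> S\<close>])
        (use N01 in \<open>auto intro: mult_left_le\<close>)
    then show ?thesis using N[OF \<open>v \<in> S\<close>] that by simp
  qed
qed

text \<open>By \<open>modulus_fixed\<close> the series for \<open>g u\<close> attains equality in
  the triangle inequality, so all its terms have the phase of \<open>g u\<close>.\<close>

lemma phase:
  fixes g :: "'a \<Rightarrow> complex"
  assumes "in_range g" "u \<in> S" "v \<in> S"
  shows "g v * f v u = cmod (g v) * cmod (f v u) * sgn (g u)"
  using has_sum_triangle_eq[where z = "\<lambda>v. g v * f v u" and w = "g u" and A = S and i = v] modulus_fixed[OF assms(1,2)] assms
  by (simp add: in_range_def norm_mult)

section \<open>The partition of the active indices into supports\<close>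

definition active :: "'a set" where
  "active = {t \<in> S. \<exists>s\<in>S. f s t \<noteq> 0}"

definition support :: "'a \<Rightarrow> 'a set" where
  "support t = {u \<in> S. f t u \<noteq> 0}"

lemma activeD: "t \<in> active \<Longrightarrow> t \<in> S"
  by (simp add: active_def)

text \<open>The moduli form an idempotent matrix by \<open>modulus_fixed\<close>, and rows reached
  through a nonzero entry have sum 1 by \<open>row_norm_eq_1\<close>. So
  \<open>stochastic_idempotent_const\<close> applies, starting at a witness \<open>s\<close> for the
  activity of \<open>t\<close> and passing from \<open>t\<close> to \<open>v\<close>.\<close>

lemma cmod_row_eq:
  assumes "t \<in> active" "v \<in> support t" "u \<in> S"
  shows "cmod (f v u) = cmod (f t u)"
proof -
  obtain s where s: "s \<in> S" "f s t \<noteq> 0" and tv: "t \<in> S" "v \<in> S" "f t v \<noteq> 0"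
    using assms by (auto simp: active_def support_def)
  show ?thesis
  proof (rule stochastic_idempotent_const[where R = "\<lambda>s u. cmod (f s u)" and S = S and s = s])
    fix s v assume sv: "s \<in> S" "v \<in> S"
    have "(\<Sum>u\<in>{v}. cmod (f s u)) \<le> (\<Sum>\<^sub>\<infinity>u\<in>S. cmod (f s u))"
      by (rule finite_sum_le_infsum[OF summable]) (use sv in auto)
    then show "cmod (f s v) \<le> 1"
      using contractive[OF sv(1)] by simp
    show "((\<lambda>u. cmod (f v u)) has_sum 1) S" if "cmod (f s v) \<noteq> 0"
      using row_norm_eq_1[OF in_range_row sv(2)] sv that by auto
    show "((\<lambda>w. cmod (f s w) * cmod (f w v)) has_sum cmod (f s v)) S"
      by (rule modulus_fixed[OF in_range_row[OF sv(1)] sv(2)])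
  qed (use s tv \<open>u \<in> S\<close> summable in auto)
qed

lemma support_eq:
  assumes "t \<in> active" "v \<in> support t"
  shows "support v = support t" "v \<in> active"
proof -
  have "f v u = 0 \<longleftrightarrow> f t u = 0" if "u \<in> S" for u
    using cmod_row_eq[OF assms that] by (metis norm_eq_zero)
  then show "support v = support t"
    by (auto simp: support_def)
  show "v \<in> active"
    using assms by (auto simp: support_def active_def)
qed

text \<open>Since \<open>f s t\<close> is nonzero, its expansion has a nonzero term
  \<open>f s v * f v t\<close>. Then \<open>v\<close> is active and \<open>t\<close> lies in its
  support, which equals the support of \<open>t\<close>. With \<open>support_eq\<close>, the
  supports thus partition \<open>active\<close>.\<close>

lemma active_in_support:
  assumes "t \<in> active"
  shows "t \<in> support t"
proof -
  obtain s where s: "s \<in> S" "f s t \<noteq> 0" "t \<in> S"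
    using assms by (auto simp: active_def)
  have "\<exists>v\<in>S. f s v * f v t \<noteq> 0"
  proof (rule ccontr)
    assume "\<not> ?thesis"
    then have "((\<lambda>v. f s v * f v t) has_sum 0) S"
      by (intro has_sum_0) blast
    then show False
      using has_sum_unique[OF idempotent[OF s(1,3)]] s(2) by blast
  qed
  then obtain v where v: "v \<in> S" "f s v * f v t \<noteq> 0"
    by blast
  then have "v \<in> active" "t \<in> support v"
    using s by (auto simp: active_def support_def)
  then show ?thesis using support_eq by blast
qed

text \<open>Rows \<open>v\<close> and \<open>t\<close> have equal moduli by
  \<open>cmod_row_eq\<close>, and \<open>phase\<close> for row \<open>t\<close> fixes the relation
  between their phases. So row \<open>v\<close> is row \<open>t\<close> times the unimodular number
  \<open>cmod (f t v) / f t v\<close>; the statement avoids the division.\<close>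

lemma row_proportional:
  assumes "t \<in> active" "v \<in> support t" "u \<in> S"
  shows "f v u * f t v = cmod (f t v) * f t u"
proof -
  have "f t v * f v u = cmod (f t v) * (cmod (f v u) * sgn (f t u))"
    using phase[OF in_range_row, of t u v] assms by (simp add: support_def activeD)
  also have "cmod (f v u) * sgn (f t u) = f t u"
    using cmod_row_eq[OF assms] by (simp add: sgn_eq)
  finally show ?thesis by (simp add: mult.commute)
qed

lemma in_range_active:
  assumes "in_range g" "u \<in> S" "g u \<noteq> 0"
  shows "u \<in> active"
proof (rule ccontr)
  assume "u \<notin> active"
  then have "f v u = 0" if "v \<in> S" for v
    using that \<open>u \<in> S\<close> by (auto simp: active_def)
  then have "((\<lambda>v. g v * f v u) has_sum 0) S"
    by (intro has_sum_0) auto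
  moreover have "((\<lambda>v. g v * f v u) has_sum g u) S"
    using assms by (simp add: in_range_def)
  ultimately show False
    using has_sum_unique \<open>g u \<noteq> 0\<close> by blast
qed

text \<open>On the class of \<open>m\<close>, every element of the range is a multiple of row
  \<open>m\<close>, with coefficient \<open>g m / f m m\<close>. Both \<open>g u\<close> and
  \<open>g m\<close> are expanded as fixed points and the two series are compared term by
  term.\<close>

lemma in_range_proportional:
  assumes g: "in_range g" and m: "m \<in> active" and u: "u \<in> support m"
  shows "g u * f m m = g m * f m u"
proof -
  have S: "m \<in> S" "u \<in> S"
    using m u by (auto simp: active_def support_def)
  \<comment> \<open>A term with \<open>g t\<close> nonzero matters only if row \<open>t\<close>
    meets the class of \<open>m\<close>. Then \<open>t\<close> belongs to that class, and its row is
    proportional to row \<open>m\<close>.\<close>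
  have "g t * f t u * f m m = g t * f t m * f m u" if "t \<in> S" for t
  proof (cases "g t = 0 \<or> f t u = 0 \<and> f t m = 0")
    case False
    have t: "t \<in> active"
      using in_range_active[OF g that] False by auto
    have "u \<in> support t \<or> m \<in> support t"
      using False S by (auto simp: support_def)
    then have "support t = support m"
      using support_eq(1)[OF t] support_eq(1)[OF m u] by auto
    then have tm: "t \<in> support m"
      using active_in_support[OF t] by simp
    then have "f t u * f m t * f m m = (f t m * f m t) * f m u"
      using row_proportional[OF m tm] S by simp
    moreover have "f m t \<noteq> 0"
      using tm by (simp add: support_def)
    ultimately have "f t u * f m m = f t m * f m u"
      by (simp add: mult_ac)
    then show ?thesis by (simp add: mult.assoc)
  qed auto
  then have "((\<lambda>t. g t * f t u * f m m) has_sum g m * f m u) S \<longleftrightarrow>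
      ((\<lambda>t. g t * f t m * f m u) has_sum g m * f m u) S"
    by (rule has_sum_cong)
  moreover have "((\<lambda>t. g t * f t u * f m m) has_sum g u * f m m) S"
    "((\<lambda>t. g t * f t m * f m u) has_sum g m * f m u) S"
    using g S by (auto simp: in_range_def intro!: has_sum_cmult_left)
  ultimately show ?thesis
    using has_sum_unique by blast
qed

section \<open>Class representatives and coordinates on the range\<close>

text \<open>The choice depends on \<open>t\<close> only through \<open>support t\<close>, so that
  all members of a class receive the same representative.\<close>

definition representative :: "'a \<Rightarrow> 'a" where
  "representative t = (SOME v. v \<in> support t)"

definition reps :: "'a set" where
  "reps = representative ` active"

lemma representative_in_support: "t \<in> active \<Longrightarrow> representative t \<in> support t"
  unfolding representative_def by (rule someI) (rule active_in_support)

lemma reps_active: "m \<in> reps \<Longrightarrow> m \<in> active"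
  using representative_in_support support_eq(2) by (auto simp: reps_def)

lemma reps_subset: "reps \<subseteq> S"
  using reps_active activeD by auto

lemma reps_diagonal_nonzero: "m \<in> reps \<Longrightarrow> f m m \<noteq> 0"
  using active_in_support[OF reps_active] by (auto simp: support_def)

lemma representative_eq:
  assumes "t \<in> active" "m \<in> reps" "support t = support m"
  shows "representative t = m"
proof -
  obtain t' where t': "t' \<in> active" "m = representative t'"
    using assms by (auto simp: reps_def)
  then have "support m = support t'"
    using support_eq(1)[OF t'(1) representative_in_support[OF t'(1)]] by simp
  then show ?thesis
    using t' assms by (simp add: representative_def)
qed

text \<open>A nonzero entry would put \<open>n\<close> into the class of \<open>m\<close>, and a
  class has only one representative. The matrix is therefore diagonal on \<open>reps\<close>, which
  later yields surjectivity.\<close>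

lemma reps_off_diagonal:
  assumes "m \<in> reps" "n \<in> reps" "n \<noteq> m"
  shows "f m n = 0"
proof (rule ccontr)
  assume "f m n \<noteq> 0"
  then have "n \<in> support m"
    using assms reps_subset by (auto simp: support_def)
  then have eq: "support n = support m"
    using assms reps_active support_eq by blast
  have "representative n = m"
    by (intro representative_eq reps_active assms eq)
  moreover have "representative n = n"
    by (intro representative_eq reps_active assms refl)
  ultimately show False using assms by simp
qed

text \<open>The norm of \<open>g\<close> is summed class by class. On the class of \<open>m\<close>,
  \<open>g\<close> equals \<open>g m / f m m\<close> times row \<open>m\<close>, and that row has
  norm 1.\<close>

lemma has_sum_coordinates:
  assumes g: "in_range g"
  shows "((\<lambda>m. cmod (g m / f m m)) has_sum (\<Sum>\<^sub>\<infinity>u\<in>S. cmod (g u))) reps"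
proof -
  have "((\<lambda>u. cmod (g u)) has_sum (\<Sum>\<^sub>\<infinity>u\<in>S. cmod (g u))) S"
    using g by (simp add: in_range_def)
  also have "?this \<longleftrightarrow> ((\<lambda>u. cmod (g u)) has_sum (\<Sum>\<^sub>\<infinity>u\<in>S. cmod (g u))) active"
    by (rule has_sum_cong_neutral) (use in_range_active[OF g] activeD in auto)
  also have "\<dots> \<longleftrightarrow> ((\<lambda>(m, u). cmod (g u)) has_sum (\<Sum>\<^sub>\<infinity>u\<in>S. cmod (g u))) (Sigma reps support)"
  proof -
    \<comment> \<open>This is the partition of \<open>active\<close> into the supports of the
      representatives, written as a bijection.\<close>
    have "bij_betw (\<lambda>u. (representative u, u)) active (Sigma reps support)"
    proof (rule bij_betwI[where g = snd])
      show "(\<lambda>u. (representative u, u)) \<in> active \<rightarrow> Sigma reps support"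
      proof
        fix u assume u: "u \<in> active"
        then have "support (representative u) = support u"
          using support_eq(1)[OF u representative_in_support[OF u]] by simp
        then show "(representative u, u) \<in> Sigma reps support"
          using u active_in_support by (auto simp: reps_def)
      qed
      show "snd \<in> Sigma reps support \<rightarrow> active"
        using support_eq(2)[OF reps_active] by auto
      show "(representative (snd p), snd p) = p" if p: "p \<in> Sigma reps support" for p
      proof -
        obtain m u where p: "p = (m, u)" "m \<in> reps" "u \<in> support m"
          using p by auto
        have "representative u = m"
          by (rule representative_eq[OF support_eq(2)[OF reps_active[OF p(2)] p(3)] p(2)
                support_eq(1)[OF reps_active[OF p(2)] p(3)]])
        then show ?thesis using p by simp
      qed
    qed auto
    from has_sum_reindex_bij_betw[OF this, where f = "\<lambda>(m, u). cmod (g u)"]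
    show ?thesis by simp
  qed
  finally show ?thesis
  proof (rule has_sum_SigmaD)
    fix m assume m: "m \<in> reps"
    obtain s where "s \<in> S" "f s m \<noteq> 0"
      using reps_active[OF m] by (auto simp: active_def)
    then have "((\<lambda>u. cmod (f m u)) has_sum 1) S"
      using row_norm_eq_1[OF in_range_row] reps_subset m by blast
    then have "((\<lambda>u. cmod (f m u)) has_sum 1) (support m)"
      by (rule has_sum_cong_neutral[THEN iffD1, rotated -1]) (auto simp: support_def)
    from has_sum_cmult_right[OF this, of "cmod (g m / f m m)"]
    have "((\<lambda>u. cmod (g m / f m m) * cmod (f m u)) has_sum cmod (g m / f m m)) (support m)"
      by simp
    also have "?this \<longleftrightarrow> ((\<lambda>u. cmod (g u)) has_sum cmod (g m / f m m)) (support m)"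
    proof (rule has_sum_cong)
      fix u assume "u \<in> support m"
      then have "g u = g m / f m m * f m u"
        using in_range_proportional[OF g reps_active[OF m]] reps_diagonal_nonzero[OF m]
        by (simp add: field_simps)
      then show "cmod (g m / f m m) * cmod (f m u) = cmod (g u)"
        by (simp add: norm_mult norm_divide)
    qed
    finally show "((\<lambda>u. case (m, u) of (m, u) \<Rightarrow> cmod (g u)) has_sum cmod (g m / f m m)) (support m)"
      by simp
  qed
qed

end

section \<open>Unordered sums in normed spaces\<close>

context complex_normed_space
begin

lemma scalar_carrier [simp]: "c \<in> carrier (ring_of_type_algebra :: complex ring)"
  by (simp add: ring_of_type_algebra_def)

lemma smult_carrier [simp]: "x \<in> carrier E \<Longrightarrow> c \<odot>\<^bsub>E\<^esub> x \<in> carrier E"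
  by simp

lemma smult_add_left:
  "x \<in> carrier E \<Longrightarrow> (a + b) \<odot>\<^bsub>E\<^esub> x = a \<odot>\<^bsub>E\<^esub> x \<oplus>\<^bsub>E\<^esub> b \<odot>\<^bsub>E\<^esub> x"
  using smult_l_distr[of a b x] by (simp add: ring_of_type_algebra_def)

lemma smult_add_right:
  "x \<in> carrier E \<Longrightarrow> y \<in> carrier E \<Longrightarrow>
    a \<odot>\<^bsub>E\<^esub> (x \<oplus>\<^bsub>E\<^esub> y) = a \<odot>\<^bsub>E\<^esub> x \<oplus>\<^bsub>E\<^esub> a \<odot>\<^bsub>E\<^esub> y"
  by (simp add: smult_r_distr)

lemma smult_smult: "x \<in> carrier E \<Longrightarrow> a \<odot>\<^bsub>E\<^esub> (b \<odot>\<^bsub>E\<^esub> x) = (a * b) \<odot>\<^bsub>E\<^esub> x"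
  using smult_assoc1[of a b x] by (simp add: ring_of_type_algebra_def)

lemma smult_1: "x \<in> carrier E \<Longrightarrow> 1 \<odot>\<^bsub>E\<^esub> x = x"
  using smult_one[of x] by (simp add: ring_of_type_algebra_def)

lemma smult_0: "x \<in> carrier E \<Longrightarrow> 0 \<odot>\<^bsub>E\<^esub> x = \<zero>\<^bsub>E\<^esub>"
  using smult_l_null[of x] by (simp add: ring_of_type_algebra_def)

lemma uminus_eq_smult: "x \<in> carrier E \<Longrightarrow> \<ominus>\<^bsub>E\<^esub> x = (-1) \<odot>\<^bsub>E\<^esub> x"
proof -
  assume x: "x \<in> carrier E"
  have "(-1) \<odot>\<^bsub>E\<^esub> x \<oplus>\<^bsub>E\<^esub> x = \<zero>\<^bsub>E\<^esub>"
    using smult_add_left[OF x, of "-1" 1] x by (simp add: smult_1 smult_0)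
  then show ?thesis
    using x by (intro M.minus_equality) auto
qed

lemma vnorm_zero [simp]: "vnorm E \<zero>\<^bsub>E\<^esub> = 0"
  by (simp add: vnorm_eq_zero_iff)

lemma vnorm_uminus: "x \<in> carrier E \<Longrightarrow> vnorm E (\<ominus>\<^bsub>E\<^esub> x) = vnorm E x"
  by (simp add: uminus_eq_smult vnorm_smult)

lemma minus_add_swap:
  assumes "a \<in> carrier E" "b \<in> carrier E" "c \<in> carrier E" "d \<in> carrier E"
  shows "(a \<oplus>\<^bsub>E\<^esub> b) \<ominus>\<^bsub>E\<^esub> (c \<oplus>\<^bsub>E\<^esub> d) = (a \<ominus>\<^bsub>E\<^esub> c) \<oplus>\<^bsub>E\<^esub> (b \<ominus>\<^bsub>E\<^esub> d)"
  using assms by (simp add: a_minus_def M.minus_add M.a_ac)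

lemma vnorm_minus_commute:
  assumes "x \<in> carrier E" "y \<in> carrier E"
  shows "vnorm E (x \<ominus>\<^bsub>E\<^esub> y) = vnorm E (y \<ominus>\<^bsub>E\<^esub> x)"
proof -
  have "\<ominus>\<^bsub>E\<^esub> (x \<ominus>\<^bsub>E\<^esub> y) = y \<ominus>\<^bsub>E\<^esub> x"
    using assms by (simp add: a_minus_def M.minus_add M.a_comm)
  then show ?thesis
    using assms vnorm_uminus[of "x \<ominus>\<^bsub>E\<^esub> y"] by simp
qed

lemma vnorm_minus_triangle:
  assumes "x \<in> carrier E" "y \<in> carrier E" "z \<in> carrier E"
  shows "vnorm E (x \<ominus>\<^bsub>E\<^esub> z) \<le> vnorm E (x \<ominus>\<^bsub>E\<^esub> y) + vnorm E (y \<ominus>\<^bsub>E\<^esub> z)"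
proof -
  have "(x \<ominus>\<^bsub>E\<^esub> y) \<oplus>\<^bsub>E\<^esub> (y \<ominus>\<^bsub>E\<^esub> z) = x \<oplus>\<^bsub>E\<^esub> (\<ominus>\<^bsub>E\<^esub> y \<oplus>\<^bsub>E\<^esub> y) \<oplus>\<^bsub>E\<^esub> \<ominus>\<^bsub>E\<^esub> z"
    using assms by (simp add: a_minus_def M.a_assoc del: M.l_neg M.r_neg)
  then have "(x \<ominus>\<^bsub>E\<^esub> y) \<oplus>\<^bsub>E\<^esub> (y \<ominus>\<^bsub>E\<^esub> z) = x \<ominus>\<^bsub>E\<^esub> z"
    using assms by (simp add: a_minus_def M.l_neg)
  then show ?thesis
    using assms vnorm_triangle[of "x \<ominus>\<^bsub>E\<^esub> y" "y \<ominus>\<^bsub>E\<^esub> z"] by simp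
qed

lemma minus_eq_zero_iff:
  assumes "x \<in> carrier E" "y \<in> carrier E"
  shows "x \<ominus>\<^bsub>E\<^esub> y = \<zero>\<^bsub>E\<^esub> \<longleftrightarrow> x = y"
proof
  assume "x \<ominus>\<^bsub>E\<^esub> y = \<zero>\<^bsub>E\<^esub>"
  then have "\<ominus>\<^bsub>E\<^esub> (\<ominus>\<^bsub>E\<^esub> y) = x"
    using assms by (intro M.minus_equality) (auto simp: a_minus_def)
  then show "x = y"
    using assms by simp
qed (use assms in \<open>simp add: a_minus_def M.r_neg\<close>)

lemma minus_self [simp]: "x \<in> carrier E \<Longrightarrow> x \<ominus>\<^bsub>E\<^esub> x = \<zero>\<^bsub>E\<^esub>"
  by (simp add: minus_eq_zero_iff)

lemma minus_zero_right [simp]: "x \<in> carrier E \<Longrightarrow> x \<ominus>\<^bsub>E\<^esub> \<zero>\<^bsub>E\<^esub> = x"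
  using smult_r_null[of "-1"] by (simp add: a_minus_def uminus_eq_smult)

lemma metric_space: "Metric_space (carrier E) (vdist E)"
proof
  show "0 \<le> vdist E x y" for x y
    by (simp add: vdist_def vnorm_nonneg)
  show "vdist E x y = vdist E y x" for x y
    using vnorm_minus_commute[of x y] by (simp add: vdist_def)
  show "vdist E x y = 0 \<longleftrightarrow> x = y" if "x \<in> carrier E" "y \<in> carrier E" for x y
    using that by (simp add: vdist_def vnorm_eq_zero_iff minus_eq_zero_iff)
  show "vdist E x z \<le> vdist E x y + vdist E y z"
    if "x \<in> carrier E" "y \<in> carrier E" "z \<in> carrier E" for x y z
    using that vnorm_minus_triangle[OF that] by (simp add: vdist_def)
qed

lemma complex_banach_spaceI:
  assumes "\<And>\<sigma>. (\<And>n. \<sigma> n \<in> carrier E) \<Longrightarrow>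
    (\<And>e. 0 < e \<Longrightarrow> \<exists>N::nat. \<forall>m\<ge>N. \<forall>n\<ge>N. vnorm E (\<sigma> m \<ominus>\<^bsub>E\<^esub> \<sigma> n) < e) \<Longrightarrow>
    \<exists>x\<in>carrier E. (\<lambda>n. vnorm E (\<sigma> n \<ominus>\<^bsub>E\<^esub> x)) \<longlonglongrightarrow> 0"
  shows "complex_banach_space E"
proof
  interpret Metric_space "carrier E" "vdist E"
    by (rule metric_space)
  show mcomplete
    unfolding mcomplete_def
  proof (intro allI impI)
    fix \<sigma> assume \<sigma>: "MCauchy \<sigma>"
    then have car: "\<sigma> n \<in> carrier E" for n
      by (auto simp: MCauchy_def)
    have vdist_eq: "vdist E (\<sigma> m) (\<sigma> n) = vnorm E (\<sigma> m \<ominus>\<^bsub>E\<^esub> \<sigma> n)" for m n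
      using car by (simp add: vdist_def)
    have "\<exists>N. \<forall>m\<ge>N. \<forall>n\<ge>N. vnorm E (\<sigma> m \<ominus>\<^bsub>E\<^esub> \<sigma> n) < e" if e: "0 < e" for e
    proof -
      obtain N where "\<And>m n. N \<le> m \<Longrightarrow> N \<le> n \<Longrightarrow> vdist E (\<sigma> m) (\<sigma> n) < e"
        using \<sigma> e unfolding MCauchy_def by meson
      then show ?thesis
        unfolding vdist_eq by (intro exI[of _ N]) simp
    qed
    from assms[OF car this]
    obtain x where "x \<in> carrier E" "(\<lambda>n. vnorm E (\<sigma> n \<ominus>\<^bsub>E\<^esub> x)) \<longlonglongrightarrow> 0"
      by blast
    moreover from this car have "(\<lambda>n. vdist E (\<sigma> n) x) = (\<lambda>n. vnorm E (\<sigma> n \<ominus>\<^bsub>E\<^esub> x))"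
      by (simp add: vdist_def)
    ultimately have "limitin mtopology \<sigma> x sequentially"
      unfolding limitin_metric_dist_null using car by simp
    then show "\<exists>x. limitin mtopology \<sigma> x sequentially" ..
  qed
qed

lemma vnorm_finsum_le:
  assumes "finite G" "f \<in> G \<rightarrow> carrier E"
  shows "vnorm E (finsum E f G) \<le> (\<Sum>i\<in>G. vnorm E (f i))"
  using assms
proof (induction G rule: finite_induct)
  case (insert i G)
  then have "vnorm E (finsum E f (insert i G)) \<le> vnorm E (f i) + vnorm E (finsum E f G)"
    by (simp add: Pi_def vnorm_triangle)
  then show ?case
    using insert by (simp add: Pi_def)
qed simp

lemma finsum_minus_subset:
  assumes "finite G" "H \<subseteq> G" "f \<in> G \<rightarrow> carrier E"
  shows "finsum E f G \<ominus>\<^bsub>E\<^esub> finsum E f H = finsum E f (G - H)"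
proof -
  have H: "finite H" "f \<in> H \<rightarrow> carrier E" "f \<in> (G - H) \<rightarrow> carrier E" "H \<union> (G - H) = G"
    using assms finite_subset by (auto simp: Pi_def)
  have "finsum E f G = finsum E f H \<oplus>\<^bsub>E\<^esub> finsum E f (G - H)"
    using M.finsum_Un_disjoint[of H "G - H" f] H assms by auto
  moreover have "(a \<oplus>\<^bsub>E\<^esub> b) \<ominus>\<^bsub>E\<^esub> a = b" if ab: "a \<in> carrier E" "b \<in> carrier E" for a b
    unfolding M.a_comm[OF ab] using ab by (simp add: a_minus_def M.a_assoc M.r_neg)
  ultimately show ?thesis
    using M.finsum_closed[OF H(2)] M.finsum_closed[OF H(3)] by simp
qed

end

lemma (in complex_banach_space) Cauchy_converges:
  assumes u: "\<And>n. u n \<in> carrier E"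
    and "\<And>e. 0 < e \<Longrightarrow> \<exists>N::nat. \<forall>m\<ge>N. \<forall>n\<ge>N. vnorm E (u m \<ominus>\<^bsub>E\<^esub> u n) < e"
  obtains x where "x \<in> carrier E" "(\<lambda>n. vnorm E (u n \<ominus>\<^bsub>E\<^esub> x)) \<longlonglongrightarrow> 0"
proof -
  interpret Metric_space "carrier E" "vdist E"
    by (rule metric_space)
  have vdist_eq: "vdist E (u m) (u n) = vnorm E (u m \<ominus>\<^bsub>E\<^esub> u n)" for m n
    using assms(1) by (simp add: vdist_def)
  have "MCauchy u"
    unfolding MCauchy_def vdist_eq
  proof (intro conjI allI impI)
    show "range u \<subseteq> carrier E"
      using assms(1) by auto
    show "\<exists>N. \<forall>n n'. N \<le> n \<longrightarrow> N \<le> n' \<longrightarrow> vnorm E (u n \<ominus>\<^bsub>E\<^esub> u n') < e" if e: "0 < e" for e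
    proof -
      obtain N where "\<forall>m\<ge>N. \<forall>n\<ge>N. vnorm E (u m \<ominus>\<^bsub>E\<^esub> u n) < e"
        using assms(2)[OF e] ..
      then show ?thesis
        by (intro exI[of _ N]) simp
    qed
  qed
  then obtain x where "limitin mtopology u x sequentially"
    using complete unfolding mcomplete_def by blast
  then have x: "x \<in> carrier E" "(\<lambda>n. vdist E (u n) x) \<longlonglongrightarrow> 0"
    unfolding limitin_metric_dist_null by simp_all
  moreover from x(1) u have "(\<lambda>n. vdist E (u n) x) = (\<lambda>n. vnorm E (u n \<ominus>\<^bsub>E\<^esub> x))"
    by (simp add: vdist_def)
  ultimately show ?thesis
    using that by simp
qed

section \<open>Convergence of unordered vector sums\<close>

text \<open>The analogue of \<open>has_sum\<close> for spaces given by carrier sets. Convergence of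
  the finite partial sums is expressed by real-valued norms, to which the usual limit calculus
  applies.\<close>

definition has_vsum :: "'a normed_module \<Rightarrow> ('i \<Rightarrow> 'a) \<Rightarrow> 'a \<Rightarrow> 'i set \<Rightarrow> bool" where
  "has_vsum E f x A \<longleftrightarrow> x \<in> carrier E \<and>
    ((\<lambda>G. vnorm E (x \<ominus>\<^bsub>E\<^esub> finsum E f G)) \<longlongrightarrow> 0) (finite_subsets_at_top A)"

context complex_normed_space
begin

lemma eventually_finsum_closed:
  assumes "f \<in> A \<rightarrow> carrier E"
  shows "\<forall>\<^sub>F G in finite_subsets_at_top A. finsum E f G \<in> carrier E"
  using assms by (intro eventually_finite_subsets_at_top_weakI M.finsum_closed) auto

lemma has_vsum_cong:
  assumes "\<And>i. i \<in> A \<Longrightarrow> f i = g i" "f \<in> A \<rightarrow> carrier E"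
  shows "has_vsum E f x A \<longleftrightarrow> has_vsum E g x A"
proof -
  have "\<forall>\<^sub>F G in finite_subsets_at_top A.
      vnorm E (x \<ominus>\<^bsub>E\<^esub> finsum E f G) = vnorm E (x \<ominus>\<^bsub>E\<^esub> finsum E g G)"
  proof (rule eventually_finite_subsets_at_top_weakI)
    fix G assume "G \<subseteq> A"
    moreover have "g i \<in> carrier E" if "i \<in> A" for i
      using funcset_mem[OF assms(2) that] assms(1)[OF that] by simp
    ultimately have "finsum E f G = finsum E g G"
      using assms(1) by (intro M.finsum_cong') auto
    then show "vnorm E (x \<ominus>\<^bsub>E\<^esub> finsum E f G) = vnorm E (x \<ominus>\<^bsub>E\<^esub> finsum E g G)"
      by simp
  qed
  from tendsto_cong[OF this] show ?thesis
    by (simp add: has_vsum_def)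
qed

lemma has_vsum_unique:
  assumes f: "f \<in> A \<rightarrow> carrier E" and x: "has_vsum E f x A" and y: "has_vsum E f y A"
  shows "x = y"
proof -
  have xy: "x \<in> carrier E" "y \<in> carrier E"
    using x y by (auto simp: has_vsum_def)
  have "((\<lambda>G. vnorm E (x \<ominus>\<^bsub>E\<^esub> finsum E f G) + vnorm E (y \<ominus>\<^bsub>E\<^esub> finsum E f G)) \<longlongrightarrow> 0 + 0)
      (finite_subsets_at_top A)"
    using x y by (intro tendsto_add) (auto simp: has_vsum_def)
  moreover have "\<forall>\<^sub>F G in finite_subsets_at_top A. vnorm E (x \<ominus>\<^bsub>E\<^esub> y) \<le>
      vnorm E (x \<ominus>\<^bsub>E\<^esub> finsum E f G) + vnorm E (y \<ominus>\<^bsub>E\<^esub> finsum E f G)"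
    using eventually_finsum_closed[OF f]
  proof eventually_elim
    case (elim G)
    then show ?case
      using vnorm_minus_triangle[of x "finsum E f G" y] vnorm_minus_commute[of y "finsum E f G"] xy
      by simp
  qed
  ultimately have "vnorm E (x \<ominus>\<^bsub>E\<^esub> y) \<le> 0 + 0"
    by (rule tendsto_lowerbound) simp
  then show ?thesis
    using xy vnorm_nonneg[of "x \<ominus>\<^bsub>E\<^esub> y"]
    by (simp add: vnorm_eq_zero_iff minus_eq_zero_iff order_antisym_conv)
qed

lemma has_vsum_add:
  assumes f: "f \<in> A \<rightarrow> carrier E" and g: "g \<in> A \<rightarrow> carrier E"
    and x: "has_vsum E f x A" and y: "has_vsum E g y A"
  shows "has_vsum E (\<lambda>i. f i \<oplus>\<^bsub>E\<^esub> g i) (x \<oplus>\<^bsub>E\<^esub> y) A"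
proof -
  have xy: "x \<in> carrier E" "y \<in> carrier E"
    using x y by (auto simp: has_vsum_def)
  have lim: "((\<lambda>G. vnorm E (x \<ominus>\<^bsub>E\<^esub> finsum E f G) + vnorm E (y \<ominus>\<^bsub>E\<^esub> finsum E g G)) \<longlongrightarrow> 0)
      (finite_subsets_at_top A)"
    using x y by (intro tendsto_add_zero) (auto simp: has_vsum_def)
  have split: "(x \<oplus>\<^bsub>E\<^esub> y) \<ominus>\<^bsub>E\<^esub> finsum E (\<lambda>i. f i \<oplus>\<^bsub>E\<^esub> g i) G =
      (x \<ominus>\<^bsub>E\<^esub> finsum E f G) \<oplus>\<^bsub>E\<^esub> (y \<ominus>\<^bsub>E\<^esub> finsum E g G)"
    and closed: "finsum E f G \<in> carrier E" "finsum E g G \<in> carrier E"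
      "finsum E (\<lambda>i. f i \<oplus>\<^bsub>E\<^esub> g i) G \<in> carrier E"
    if "G \<subseteq> A" for G
  proof -
    have fg: "f \<in> G \<rightarrow> carrier E" "g \<in> G \<rightarrow> carrier E"
      using f g that by auto
    then show "finsum E f G \<in> carrier E" "finsum E g G \<in> carrier E"
      "finsum E (\<lambda>i. f i \<oplus>\<^bsub>E\<^esub> g i) G \<in> carrier E"
      by (auto intro!: M.finsum_closed)
    with fg show "(x \<oplus>\<^bsub>E\<^esub> y) \<ominus>\<^bsub>E\<^esub> finsum E (\<lambda>i. f i \<oplus>\<^bsub>E\<^esub> g i) G =
      (x \<ominus>\<^bsub>E\<^esub> finsum E f G) \<oplus>\<^bsub>E\<^esub> (y \<ominus>\<^bsub>E\<^esub> finsum E g G)"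
      using xy by (simp add: M.finsum_addf minus_add_swap)
  qed
  have "((\<lambda>G. vnorm E ((x \<oplus>\<^bsub>E\<^esub> y) \<ominus>\<^bsub>E\<^esub> finsum E (\<lambda>i. f i \<oplus>\<^bsub>E\<^esub> g i) G)) \<longlongrightarrow> 0)
      (finite_subsets_at_top A)"
  proof (rule tendsto_sandwich[OF _ _ tendsto_const lim]; rule eventually_finite_subsets_at_top_weakI)
    fix G assume G: "G \<subseteq> A"
    show "0 \<le> vnorm E ((x \<oplus>\<^bsub>E\<^esub> y) \<ominus>\<^bsub>E\<^esub> finsum E (\<lambda>i. f i \<oplus>\<^bsub>E\<^esub> g i) G)"
      using closed[OF G] xy by (simp add: vnorm_nonneg)
    show "vnorm E ((x \<oplus>\<^bsub>E\<^esub> y) \<ominus>\<^bsub>E\<^esub> finsum E (\<lambda>i. f i \<oplus>\<^bsub>E\<^esub> g i) G) \<le>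
      vnorm E (x \<ominus>\<^bsub>E\<^esub> finsum E f G) + vnorm E (y \<ominus>\<^bsub>E\<^esub> finsum E g G)"
      using closed[OF G] xy by (simp add: split[OF G] vnorm_triangle)
  qed
  then show ?thesis
    using xy by (simp add: has_vsum_def)
qed

lemma has_vsum_single:
  assumes "a \<in> A" "f \<in> A \<rightarrow> carrier E" "\<And>i. i \<in> A \<Longrightarrow> i \<noteq> a \<Longrightarrow> f i = \<zero>\<^bsub>E\<^esub>"
  shows "has_vsum E f (f a) A"
proof -
  have "vnorm E (f a \<ominus>\<^bsub>E\<^esub> finsum E f G) = 0" if "{a} \<subseteq> G" "G \<subseteq> A" "finite G" for G
  proof -
    have "finsum E f (G - {a}) = \<zero>\<^bsub>E\<^esub>"
      using assms(3) that by (intro M.add.finprod_one_eqI) auto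
    then have "finsum E f (insert a (G - {a})) = f a"
      using assms(1,2) that by (subst M.finsum_insert) (auto simp: Pi_def)
    moreover have "insert a (G - {a}) = G" using that by auto
    moreover have "f a \<in> carrier E" using assms by auto
    ultimately show ?thesis by simp
  qed
  then have "((\<lambda>G. vnorm E (f a \<ominus>\<^bsub>E\<^esub> finsum E f G)) \<longlongrightarrow> 0) (finite_subsets_at_top A)"
    using assms(1) by (intro tendsto_eventually)
      (auto simp: eventually_finite_subsets_at_top intro!: exI[of _ "{a}"])
  then show ?thesis
    using assms by (auto simp: has_vsum_def)
qed

lemma vnorm_has_vsum_le:
  assumes f: "f \<in> A \<rightarrow> carrier E" and x: "has_vsum E f x A"
    and summ: "(\<lambda>i. vnorm E (f i)) summable_on A"
  shows "vnorm E x \<le> (\<Sum>\<^sub>\<infinity>i\<in>A. vnorm E (f i))"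
proof -
  have xc: "x \<in> carrier E"
    using x by (simp add: has_vsum_def)
  have "((\<lambda>G. vnorm E (x \<ominus>\<^bsub>E\<^esub> finsum E f G) + (\<Sum>i\<in>G. vnorm E (f i))) \<longlongrightarrow>
      0 + (\<Sum>\<^sub>\<infinity>i\<in>A. vnorm E (f i))) (finite_subsets_at_top A)"
    using x summ by (intro tendsto_add infsum_tendsto) (auto simp: has_vsum_def)
  moreover have "\<forall>\<^sub>F G in finite_subsets_at_top A.
      vnorm E x \<le> vnorm E (x \<ominus>\<^bsub>E\<^esub> finsum E f G) + (\<Sum>i\<in>G. vnorm E (f i))"
  proof (rule eventually_finite_subsets_at_top_weakI)
    fix G assume G: "finite G" "G \<subseteq> A"
    then have fG: "f \<in> G \<rightarrow> carrier E"
      using f by auto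
    show "vnorm E x \<le> vnorm E (x \<ominus>\<^bsub>E\<^esub> finsum E f G) + (\<Sum>i\<in>G. vnorm E (f i))"
      using vnorm_minus_triangle[of x "finsum E f G" "\<zero>\<^bsub>E\<^esub>"] vnorm_finsum_le[OF G(1) fG]
        xc M.finsum_closed[OF fG] by simp
  qed
  ultimately have "vnorm E x \<le> 0 + (\<Sum>\<^sub>\<infinity>i\<in>A. vnorm E (f i))"
    by (rule tendsto_lowerbound) simp
  then show ?thesis by simp
qed

end

text \<open>Absolute summability implies convergence: along an increasing sequence of finite sets
  that nearly exhausts the sum of the norms, the partial sums are Cauchy, and their limit is then
  the limit of the whole net.\<close>

lemma (in complex_banach_space) ex_has_vsum:
  assumes f: "f \<in> A \<rightarrow> carrier E" and summ: "(\<lambda>i. vnorm E (f i)) summable_on A"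
  shows "\<exists>x. has_vsum E f x A"
proof -
  define s where "s = (\<Sum>\<^sub>\<infinity>i\<in>A. vnorm E (f i))"
  have s: "((\<lambda>i. vnorm E (f i)) has_sum s) A"
    using summ by (simp add: s_def)
  have "\<exists>H. finite H \<and> H \<subseteq> A \<and> dist (\<Sum>i\<in>H. vnorm E (f i)) s \<le> inverse (real (Suc n))" for n
    by (rule has_sum_finite_approximation[OF s]) simp
  then obtain H where H: "finite (H n)" "H n \<subseteq> A"
    "dist (\<Sum>i\<in>H n. vnorm E (f i)) s \<le> inverse (real (Suc n))" for n
    by metis
  \<comment> \<open>Unions make the approximating sets increasing, so that \<open>tail\<close> can
    compare \<open>K m\<close> with \<open>K N\<close>.\<close>
  define K where "K n = (\<Union>k\<le>n. H k)" for n
  have K: "finite (K n)" "K n \<subseteq> A" "H n \<subseteq> K n" for n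
    using H by (auto simp: K_def)
  have K_mono: "K m \<subseteq> K n" if "m \<le> n" for m n
    unfolding K_def using that by (intro UN_mono) auto
  have fc: "f \<in> G \<rightarrow> carrier E" if "G \<subseteq> A" for G
    using f that by auto
  have nn: "0 \<le> vnorm E (f i)" if "i \<in> A" for i
    using f that vnorm_nonneg by auto
  \<comment> \<open>The norms over \<open>H n\<close>, hence over \<open>K n\<close>, already sum to
    within \<open>inverse (real (Suc n))\<close> of \<open>s\<close>, and this bounds everything
    that \<open>G\<close> adds.\<close>
  have tail: "vnorm E (finsum E f G \<ominus>\<^bsub>E\<^esub> finsum E f (K n)) \<le> inverse (real (Suc n))"
    if G: "finite G" "G \<subseteq> A" "K n \<subseteq> G" for G n
  proof -
    have "(\<Sum>i\<in>G. vnorm E (f i)) \<le> s"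
      by (rule finite_sum_le_has_sum[OF s]) (use G nn in auto)
    moreover have "(\<Sum>i\<in>H n. vnorm E (f i)) \<le> (\<Sum>i\<in>K n. vnorm E (f i))"
      by (rule sum_mono2[OF K(1,3)]) (use K(2)[of n] nn in auto)
    moreover have "(\<Sum>i\<in>G. vnorm E (f i)) = (\<Sum>i\<in>K n. vnorm E (f i)) + (\<Sum>i\<in>G - K n. vnorm E (f i))"
      using sum.subset_diff[OF G(3,1)] by (simp add: add.commute)
    ultimately have "(\<Sum>i\<in>G - K n. vnorm E (f i)) \<le> inverse (real (Suc n))"
      using H(3)[of n] by (simp add: dist_real_def)
    moreover have "vnorm E (finsum E f (G - K n)) \<le> (\<Sum>i\<in>G - K n. vnorm E (f i))"
      by (rule vnorm_finsum_le) (use G fc in auto)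
    ultimately show ?thesis
      using finsum_minus_subset[OF G(1,3) fc[OF G(2)]] by simp
  qed
  have Kc: "finsum E f (K n) \<in> carrier E" for n
    by (rule M.finsum_closed[OF fc[OF K(2)]])
  have K_Cauchy: "\<exists>N. \<forall>m\<ge>N. \<forall>n\<ge>N. vnorm E (finsum E f (K m) \<ominus>\<^bsub>E\<^esub> finsum E f (K n)) < e"
    if e: "0 < e" for e
  proof -
    obtain N where N: "inverse (real (Suc N)) < e / 2"
      using reals_Archimedean[OF half_gt_zero[OF e]] by blast
    have close: "vnorm E (finsum E f (K m) \<ominus>\<^bsub>E\<^esub> finsum E f (K N)) < e / 2" if "N \<le> m" for m
      using tail[OF K(1,2) K_mono[OF that]] N by linarith
    have "vnorm E (finsum E f (K m) \<ominus>\<^bsub>E\<^esub> finsum E f (K n)) < e" if "N \<le> m" "N \<le> n" for m n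
      using close[OF that(1)] close[OF that(2)] Kc
        vnorm_minus_triangle[of "finsum E f (K m)" "finsum E f (K N)" "finsum E f (K n)"]
        vnorm_minus_commute[of "finsum E f (K n)" "finsum E f (K N)"] by simp
    then show ?thesis by blast
  qed
  obtain x where x: "x \<in> carrier E"
    "(\<lambda>n. vnorm E (finsum E f (K n) \<ominus>\<^bsub>E\<^esub> x)) \<longlonglongrightarrow> 0"
    by (rule Cauchy_converges[OF Kc K_Cauchy])
  have "((\<lambda>G. vnorm E (x \<ominus>\<^bsub>E\<^esub> finsum E f G)) \<longlongrightarrow> 0) (finite_subsets_at_top A)"
  proof (rule tendstoI)
    fix e :: real assume e: "0 < e"
    have "\<forall>\<^sub>F n in sequentially. vnorm E (finsum E f (K n) \<ominus>\<^bsub>E\<^esub> x) < e / 2"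
      by (rule order_tendstoD(2)[OF x(2) half_gt_zero[OF e]])
    moreover have "\<forall>\<^sub>F n in sequentially. inverse (real (Suc n)) < e / 2"
      by (rule order_tendstoD(2)[OF LIMSEQ_inverse_real_of_nat half_gt_zero[OF e]])
    ultimately have "\<forall>\<^sub>F n in sequentially.
        vnorm E (finsum E f (K n) \<ominus>\<^bsub>E\<^esub> x) < e / 2 \<and> inverse (real (Suc n)) < e / 2"
      by (rule eventually_conj)
    then obtain n where n: "vnorm E (finsum E f (K n) \<ominus>\<^bsub>E\<^esub> x) < e / 2" "inverse (real (Suc n)) < e / 2"
      using eventually_happens'[OF sequentially_bot] by blast
    \<comment> \<open>The partial sum over \<open>K n\<close> is used as an intermediate point; one
      half of \<open>e\<close> comes from its distance to \<open>x\<close>, the other from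
      \<open>tail\<close>.\<close>
    have "dist (vnorm E (x \<ominus>\<^bsub>E\<^esub> finsum E f G)) 0 < e" if G: "finite G" "K n \<subseteq> G" "G \<subseteq> A" for G
    proof -
      have Gc: "finsum E f G \<in> carrier E"
        by (rule M.finsum_closed[OF fc[OF G(3)]])
      then have "vnorm E (x \<ominus>\<^bsub>E\<^esub> finsum E f G) < e"
        using vnorm_minus_triangle[OF x(1) Kc[of n] Gc] tail[OF G(1,3,2)] n
          vnorm_minus_commute[OF x(1) Kc[of n]] vnorm_minus_commute[OF Gc Kc[of n]] by linarith
      then show ?thesis
        using Gc x(1) vnorm_nonneg[of "x \<ominus>\<^bsub>E\<^esub> finsum E f G"] by simp
    qed
    then show "\<forall>\<^sub>F G in finite_subsets_at_top A. dist (vnorm E (x \<ominus>\<^bsub>E\<^esub> finsum E f G)) 0 < e"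
      unfolding eventually_finite_subsets_at_top using K(1,2)[of n] by (intro exI[of _ "K n"]) simp
  qed
  then show ?thesis
    using x(1) by (auto simp: has_vsum_def)
qed

section \<open>Linear maps and unordered sums\<close>

lemma linear_operatorD:
  assumes "linear_operator E F T"
  shows "x \<in> carrier E \<Longrightarrow> T x \<in> carrier F"
    and "x \<in> carrier E \<Longrightarrow> y \<in> carrier E \<Longrightarrow> T (x \<oplus>\<^bsub>E\<^esub> y) = T x \<oplus>\<^bsub>F\<^esub> T y"
    and "x \<in> carrier E \<Longrightarrow> T (c \<odot>\<^bsub>E\<^esub> x) = c \<odot>\<^bsub>F\<^esub> T x"
  using assms by (auto simp: linear_operator_def)

locale linear_map = E: complex_normed_space E + F: complex_normed_space F
  for E :: "'a normed_module" and F :: "'b normed_module" +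
  fixes T :: "'a \<Rightarrow> 'b"
  assumes linear: "linear_operator E F T"
begin

lemmas linear_simps = linear_operatorD[OF linear]

lemma map_zero: "T \<zero>\<^bsub>E\<^esub> = \<zero>\<^bsub>F\<^esub>"
  using linear_simps(3)[of "\<zero>\<^bsub>E\<^esub>" 0] linear_simps(1)[of "\<zero>\<^bsub>E\<^esub>"] by (simp add: E.smult_0 F.smult_0)

lemma map_minus:
  "x \<in> carrier E \<Longrightarrow> y \<in> carrier E \<Longrightarrow> T (x \<ominus>\<^bsub>E\<^esub> y) = T x \<ominus>\<^bsub>F\<^esub> T y"
  by (simp add: a_minus_def E.uminus_eq_smult F.uminus_eq_smult linear_simps)

lemma map_finsum:
  assumes "finite G" "f \<in> G \<rightarrow> carrier E"
  shows "T (finsum E f G) = finsum F (\<lambda>i. T (f i)) G"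
  using assms
proof (induction G rule: finite_induct)
  case empty
  then show ?case by (simp add: map_zero)
next
  case (insert i G)
  then show ?case
    by (simp add: Pi_def linear_simps)
qed

text \<open>The remainder of the image series is the image of the remainder, and its norm grows at
  most by the factor \<open>K\<close>.\<close>

lemma map_has_vsum:
  assumes K: "\<And>x. x \<in> carrier E \<Longrightarrow> vnorm F (T x) \<le> K * vnorm E x"
    and f: "f \<in> A \<rightarrow> carrier E" and x: "has_vsum E f x A"
  shows "has_vsum F (\<lambda>i. T (f i)) (T x) A"
proof -
  have xc: "x \<in> carrier E"
    and lim: "((\<lambda>G. vnorm E (x \<ominus>\<^bsub>E\<^esub> finsum E f G)) \<longlongrightarrow> 0) (finite_subsets_at_top A)"
    using x by (auto simp: has_vsum_def)
  have lim: "((\<lambda>G. K * vnorm E (x \<ominus>\<^bsub>E\<^esub> finsum E f G)) \<longlongrightarrow> 0) (finite_subsets_at_top A)"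
    by (rule tendsto_mult_right_zero[OF lim])
  have "((\<lambda>G. vnorm F (T x \<ominus>\<^bsub>F\<^esub> finsum F (\<lambda>i. T (f i)) G)) \<longlongrightarrow> 0) (finite_subsets_at_top A)"
  proof (rule tendsto_sandwich[OF _ _ tendsto_const lim]; rule eventually_finite_subsets_at_top_weakI)
    fix G assume G: "finite G" "G \<subseteq> A"
    have fG: "f \<in> G \<rightarrow> carrier E"
      using f G by auto
    have eq: "T x \<ominus>\<^bsub>F\<^esub> finsum F (\<lambda>i. T (f i)) G = T (x \<ominus>\<^bsub>E\<^esub> finsum E f G)"
      using G(1) fG xc by (simp add: map_finsum map_minus)
    show "0 \<le> vnorm F (T x \<ominus>\<^bsub>F\<^esub> finsum F (\<lambda>i. T (f i)) G)"
      "vnorm F (T x \<ominus>\<^bsub>F\<^esub> finsum F (\<lambda>i. T (f i)) G) \<le> K * vnorm E (x \<ominus>\<^bsub>E\<^esub> finsum E f G)"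
      unfolding eq using fG xc by (auto intro!: K F.vnorm_nonneg linear_simps)
  qed
  then show ?thesis
    using xc by (simp add: has_vsum_def linear_simps)
qed

lemma isometry_imp_inj:
  assumes "\<And>x. x \<in> carrier E \<Longrightarrow> vnorm F (T x) = vnorm E x"
  shows "inj_on T (carrier E)"
proof (rule inj_onI)
  fix x y assume xy: "x \<in> carrier E" "y \<in> carrier E" "T x = T y"
  then have "vnorm E (x \<ominus>\<^bsub>E\<^esub> y) = 0"
    using assms[of "x \<ominus>\<^bsub>E\<^esub> y"] by (simp add: map_minus linear_simps F.minus_eq_zero_iff[THEN iffD2])
  then show "x = y"
    using xy by (simp add: E.vnorm_eq_zero_iff E.minus_eq_zero_iff)
qed

end

lemma (in complex_normed_space) has_vsum_smult:
  assumes f: "f \<in> A \<rightarrow> carrier E" and x: "has_vsum E f x A"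
  shows "has_vsum E (\<lambda>i. c \<odot>\<^bsub>E\<^esub> f i) (c \<odot>\<^bsub>E\<^esub> x) A"
proof -
  interpret linear_map E E "\<lambda>x. c \<odot>\<^bsub>E\<^esub> x"
    by unfold_locales
      (auto simp: linear_operator_def smult_add_right smult_smult mult.commute)
  show ?thesis
    by (rule map_has_vsum[where K = "cmod c", OF _ f x]) (simp add: vnorm_smult)
qed

section \<open>The Banach space \<open>l\<^sub>1(M)\<close>\<close>

lemma l1_simps [simp]:
  "carrier (l1_space M) = {f. (\<forall>m. m \<notin> M \<longrightarrow> f m = 0) \<and> (\<lambda>m. cmod (f m)) summable_on M}"
  "\<zero>\<^bsub>l1_space M\<^esub> = (\<lambda>m. 0)"
  "f \<oplus>\<^bsub>l1_space M\<^esub> g = (\<lambda>m. f m + g m)"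
  "c \<odot>\<^bsub>l1_space M\<^esub> f = (\<lambda>m. c * f m)"
  "vnorm (l1_space M) f = (\<Sum>\<^sub>\<infinity>m\<in>M. cmod (f m))"
  by (simp_all add: l1_space_def)

lemma summable_on_cmod_add:
  "(\<lambda>m. cmod (f m)) summable_on M \<Longrightarrow> (\<lambda>m. cmod (g m)) summable_on M \<Longrightarrow>
    (\<lambda>m. cmod (f m + g m)) summable_on M"
  by (rule summable_on_comparison_test[OF summable_on_add[of "\<lambda>m. cmod (f m)" M "\<lambda>m. cmod (g m)"]])
    (auto intro: norm_triangle_ineq)

lemma l1_normed: "complex_normed_space (l1_space M)"
proof -
  have smult: "(\<lambda>m. cmod (c * f m)) summable_on M" if "(\<lambda>m. cmod (f m)) summable_on M"
    for c :: complex and f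
    using that by (simp add: norm_mult summable_on_cmult_right)
  have "abelian_group (l1_space M)"
  proof (rule abelian_groupI)
    fix f assume f: "f \<in> carrier (l1_space M)"
    show "\<exists>g\<in>carrier (l1_space M). g \<oplus>\<^bsub>l1_space M\<^esub> f = \<zero>\<^bsub>l1_space M\<^esub>"
      by (rule bexI[of _ "\<lambda>m. - f m"]) (use f in auto)
  qed (auto simp: summable_on_cmod_add add_ac)
  moreover have "cring (ring_of_type_algebra :: complex ring)" ..
  ultimately have "module (ring_of_type_algebra :: complex ring) (l1_space M)"
    by (intro moduleI) (auto simp: ring_of_type_algebra_def smult algebra_simps)
  then show ?thesis
  proof (rule complex_normed_space.intro, unfold_locales)
    fix f assume f: "f \<in> carrier (l1_space M)"
    then show "0 \<le> vnorm (l1_space M) f"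
      by (auto intro: infsum_nonneg)
    show "vnorm (l1_space M) f = 0 \<longleftrightarrow> f = \<zero>\<^bsub>l1_space M\<^esub>"
    proof
      assume "vnorm (l1_space M) f = 0"
      then have "cmod (f m) = 0" if "m \<in> M" for m
        using f that by (intro nonneg_infsum_le_0D[of "\<lambda>m. cmod (f m)" M]) auto
      then show "f = \<zero>\<^bsub>l1_space M\<^esub>"
        using f by auto
    qed simp
    show "vnorm (l1_space M) (c \<odot>\<^bsub>l1_space M\<^esub> f) = cmod c * vnorm (l1_space M) f" for c
      by (simp add: norm_mult infsum_cmult_right')
    fix g assume g: "g \<in> carrier (l1_space M)"
    have "(\<Sum>\<^sub>\<infinity>m\<in>M. cmod (f m + g m)) \<le> (\<Sum>\<^sub>\<infinity>m\<in>M. cmod (f m) + cmod (g m))"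
      using f g by (intro infsum_mono summable_on_cmod_add summable_on_add norm_triangle_ineq) auto
    also have "\<dots> = (\<Sum>\<^sub>\<infinity>m\<in>M. cmod (f m)) + (\<Sum>\<^sub>\<infinity>m\<in>M. cmod (g m))"
      using f g by (intro infsum_add) auto
    finally show "vnorm (l1_space M) (f \<oplus>\<^bsub>l1_space M\<^esub> g) \<le> vnorm (l1_space M) f + vnorm (l1_space M) g"
      by simp
  qed
qed

lemma l1_minus:
  assumes "f \<in> carrier (l1_space M)" "g \<in> carrier (l1_space M)"
  shows "f \<ominus>\<^bsub>l1_space M\<^esub> g = (\<lambda>m. f m - g m)"
  unfolding a_minus_def complex_normed_space.uminus_eq_smult[OF l1_normed assms(2)] by simp

lemma l1_minus_closed:
  assumes "f \<in> carrier (l1_space M)" "g \<in> carrier (l1_space M)"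
  shows "(\<lambda>m. f m - g m) \<in> carrier (l1_space M)"
proof -
  interpret complex_normed_space "l1_space M"
    by (rule l1_normed)
  show ?thesis
    using M.minus_closed[OF assms] l1_minus[OF assms] by simp
qed

lemma sum_cmod_le_l1_norm:
  "f \<in> carrier (l1_space M) \<Longrightarrow> finite G \<Longrightarrow> G \<subseteq> M \<Longrightarrow>
    (\<Sum>m\<in>G. cmod (f m)) \<le> vnorm (l1_space M) f"
  by (auto intro!: finite_sum_le_infsum)

lemma cmod_le_l1_norm:
  assumes "f \<in> carrier (l1_space M)"
  shows "cmod (f m) \<le> vnorm (l1_space M) f"
proof (cases "m \<in> M")
  case True
  then show ?thesis
    using sum_cmod_le_l1_norm[OF assms, of "{m}"] by simp
next
  case False
  then show ?thesis
    using assms by (auto intro: infsum_nonneg)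
qed

text \<open>The limit is taken coordinatewise. The Cauchy estimate passes to the limit on finite
  index sets, uniformly in the set, and this gives both membership of the limit and convergence in
  norm.\<close>

lemma l1_banach: "complex_banach_space (l1_space M)"
proof (rule complex_normed_space.complex_banach_spaceI[OF l1_normed])
  fix u :: "nat \<Rightarrow> 'a \<Rightarrow> complex"
  assume u: "\<And>n. u n \<in> carrier (l1_space M)"
    and Cauchy_u: "\<And>e. 0 < e \<Longrightarrow>
      \<exists>N. \<forall>m\<ge>N. \<forall>n\<ge>N. vnorm (l1_space M) (u m \<ominus>\<^bsub>l1_space M\<^esub> u n) < e"
  have "Cauchy (\<lambda>n. u n m)" for m
  proof (rule CauchyI)
    fix e :: real assume "0 < e"
    then obtain N where N: "\<forall>i\<ge>N. \<forall>j\<ge>N. vnorm (l1_space M) (u i \<ominus>\<^bsub>l1_space M\<^esub> u j) < e"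
      using Cauchy_u by blast
    have "cmod (u i m - u j m) < e" if "N \<le> i" "N \<le> j" for i j
      using cmod_le_l1_norm[OF l1_minus_closed[OF u[of i] u[of j]], of m] N[rule_format, OF that]
      by (simp add: l1_minus[OF u u])
    then show "\<exists>N. \<forall>i\<ge>N. \<forall>j\<ge>N. cmod (u i m - u j m) < e" by blast
  qed
  then have "\<forall>m. \<exists>l. (\<lambda>n. u n m) \<longlonglongrightarrow> l"
    by (simp add: Cauchy_convergent convergent_def[symmetric])
  then obtain f where f: "(\<lambda>n. u n m) \<longlonglongrightarrow> f m" for m
    by metis
  have f0: "f m = 0" if "m \<notin> M" for m
  proof -
    have "u n m = 0" for n
      using u[of n] that by simp
    then show ?thesis
      using LIMSEQ_unique[OF f[of m]] by simp
  qed
  \<comment> \<open>Only finite sums are bounded here, because summability of \<open>u n - f\<close>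
    is not yet known; it is deduced from this bound in \<open>diff\<close>.\<close>
  have close: "\<exists>N. \<forall>n\<ge>N. \<forall>G. finite G \<longrightarrow> G \<subseteq> M \<longrightarrow> (\<Sum>m\<in>G. cmod (u n m - f m)) \<le> e"
    if e: "0 < e" for e
  proof -
    obtain N where N: "\<forall>i\<ge>N. \<forall>j\<ge>N. vnorm (l1_space M) (u i \<ominus>\<^bsub>l1_space M\<^esub> u j) < e"
      using Cauchy_u[OF e] by blast
    have "(\<Sum>m\<in>G. cmod (u n m - f m)) \<le> e" if n: "N \<le> n" and G: "finite G" "G \<subseteq> M" for n G
    proof (rule tendsto_upperbound)
      show "(\<lambda>j. \<Sum>m\<in>G. cmod (u n m - u j m)) \<longlonglongrightarrow> (\<Sum>m\<in>G. cmod (u n m - f m))"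
        by (intro tendsto_intros f)
      have "(\<Sum>m\<in>G. cmod (u n m - u j m)) \<le> e" if "N \<le> j" for j
        using sum_cmod_le_l1_norm[OF l1_minus_closed[OF u[of n] u[of j]] G] N[rule_format, OF n that]
        by (simp add: l1_minus[OF u u])
      then show "\<forall>\<^sub>F j in sequentially. (\<Sum>m\<in>G. cmod (u n m - u j m)) \<le> e"
        by (auto simp: eventually_sequentially)
    qed simp
    then show ?thesis by blast
  qed
  have diff: "(\<lambda>m. u n m - f m) \<in> carrier (l1_space M)"
    if "\<forall>G. finite G \<longrightarrow> G \<subseteq> M \<longrightarrow> (\<Sum>m\<in>G. cmod (u n m - f m)) \<le> e" for n e
  proof -
    have "(\<lambda>m. cmod (u n m - f m)) summable_on M"
      using that by (intro nonneg_bdd_above_summable_on) (auto intro!: bdd_aboveI2[where M = e])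
    then show ?thesis
      using u[of n] f0 by simp
  qed
  have fc: "f \<in> carrier (l1_space M)"
  proof -
    obtain N where "\<forall>n\<ge>N. \<forall>G. finite G \<longrightarrow> G \<subseteq> M \<longrightarrow> (\<Sum>m\<in>G. cmod (u n m - f m)) \<le> 1"
      using close[OF zero_less_one] ..
    then have "(\<lambda>m. u N m - f m) \<in> carrier (l1_space M)"
      by (intro diff[of N 1]) simp
    \<comment> \<open>Here \<open>f\<close> is recovered as \<open>u N - (u N - f)\<close>.\<close>
    from l1_minus_closed[OF u[of N] this] show ?thesis
      by (simp only: diff_diff_eq2 add_diff_cancel_left')
  qed
  have "(\<lambda>n. vnorm (l1_space M) (u n \<ominus>\<^bsub>l1_space M\<^esub> f)) \<longlonglongrightarrow> 0"
  proof (rule LIMSEQ_I)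
    fix e :: real assume "0 < e"
    then obtain N where N: "\<forall>n\<ge>N. \<forall>G. finite G \<longrightarrow> G \<subseteq> M \<longrightarrow> (\<Sum>m\<in>G. cmod (u n m - f m)) \<le> e / 2"
      using close[OF half_gt_zero] by blast
    have "norm (vnorm (l1_space M) (u n \<ominus>\<^bsub>l1_space M\<^esub> f) - 0) < e" if "N \<le> n" for n
    proof -
      have "(\<Sum>\<^sub>\<infinity>m\<in>M. cmod (u n m - f m)) \<le> e / 2"
      proof (rule infsum_le_finite_sums)
        show "(\<lambda>m. cmod (u n m - f m)) summable_on M"
          using diff[of n "e / 2"] N that by simp
        show "(\<Sum>m\<in>G. cmod (u n m - f m)) \<le> e / 2" if "finite G" "G \<subseteq> M" for G
          using N[rule_format, OF \<open>N \<le> n\<close> that] .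
      qed
      moreover have "0 \<le> (\<Sum>\<^sub>\<infinity>m\<in>M. cmod (u n m - f m))"
        by (rule infsum_nonneg) simp
      ultimately show ?thesis
        using \<open>0 < e\<close> by (simp add: l1_minus[OF u fc])
    qed
    then show "\<exists>N. \<forall>n\<ge>N. norm (vnorm (l1_space M) (u n \<ominus>\<^bsub>l1_space M\<^esub> f) - 0) < e" by blast
  qed
  with fc show "\<exists>x\<in>carrier (l1_space M). (\<lambda>n. vnorm (l1_space M) (u n \<ominus>\<^bsub>l1_space M\<^esub> x)) \<longlonglongrightarrow> 0"
    by blast
qed

lemma l1_finsum:
  assumes "finite G" "g \<in> G \<rightarrow> carrier (l1_space M)"
  shows "finsum (l1_space M) g G u = (\<Sum>i\<in>G. g i u)"
proof -
  interpret complex_normed_space "l1_space M"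
    by (rule l1_normed)
  show ?thesis
    using assms
  proof (induction G rule: finite_induct)
    case (insert i G)
    then show ?case
      by (subst M.finsum_insert) (auto simp: Pi_def)
  qed simp
qed

text \<open>Evaluation at \<open>u\<close> is a contraction by \<open>cmod_le_l1_norm\<close>, so
  convergence in norm implies convergence of every coordinate.\<close>

lemma l1_has_vsumD:
  assumes g: "g \<in> A \<rightarrow> carrier (l1_space M)" and h: "has_vsum (l1_space M) g h A"
  shows "((\<lambda>i. g i u) has_sum h u) A"
proof -
  interpret complex_normed_space "l1_space M"
    by (rule l1_normed)
  have hc: "h \<in> carrier (l1_space M)"
    and lim: "((\<lambda>G. vnorm (l1_space M) (h \<ominus>\<^bsub>l1_space M\<^esub> finsum (l1_space M) g G)) \<longlongrightarrow> 0)
      (finite_subsets_at_top A)"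
    using h by (auto simp: has_vsum_def)
  have "((\<lambda>G. h u - (\<Sum>i\<in>G. g i u)) \<longlongrightarrow> 0) (finite_subsets_at_top A)"
  proof (rule Lim_null_comparison[OF eventually_finite_subsets_at_top_weakI lim])
    fix G assume G: "finite G" "G \<subseteq> A"
    then have gG: "g \<in> G \<rightarrow> carrier (l1_space M)"
      using g by blast
    note G_closed = M.finsum_closed[OF gG]
    show "norm (h u - (\<Sum>i\<in>G. g i u)) \<le> vnorm (l1_space M) (h \<ominus>\<^bsub>l1_space M\<^esub> finsum (l1_space M) g G)"
      using cmod_le_l1_norm[OF l1_minus_closed[OF hc G_closed], of u]
      unfolding l1_minus[OF hc G_closed] l1_finsum[OF G(1) gG] .
  qed
  then have "((\<lambda>G. h u - (h u - (\<Sum>i\<in>G. g i u))) \<longlongrightarrow> h u - 0) (finite_subsets_at_top A)"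
    by (intro tendsto_diff tendsto_const)
  then show ?thesis
    by (simp add: has_sum_def)
qed

section \<open>Transport of structure along an injection\<close>

text \<open>For \<open>j\<close> injective on the carrier this is an isometric copy of
  \<open>P\<close> with points in \<open>'b\<close>; all operations are pulled back along the
  inverse of \<open>j\<close>.\<close>

definition transport :: "('a \<Rightarrow> 'b) \<Rightarrow> 'a normed_module \<Rightarrow> 'b normed_module" where
  "transport j P = (let i = inv_into (carrier P) j in
    \<lparr>carrier = j ` carrier P, monoid.mult = undefined, one = undefined,
     ring.zero = j \<zero>\<^bsub>P\<^esub>, add = (\<lambda>x y. j (i x \<oplus>\<^bsub>P\<^esub> i y)),
     smult = (\<lambda>c x. j (c \<odot>\<^bsub>P\<^esub> i x)), vnorm = (\<lambda>x. vnorm P (i x))\<rparr>)"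

context
  fixes P :: "'a normed_module" and j :: "'a \<Rightarrow> 'b"
  assumes banach_P: "complex_banach_space P" and inj_j: "inj_on j (carrier P)"
begin

interpretation P: complex_banach_space P
  by (rule banach_P)

lemma transport_simps [simp]:
  "carrier (transport j P) = j ` carrier P"
  "\<zero>\<^bsub>transport j P\<^esub> = j \<zero>\<^bsub>P\<^esub>"
  "x \<in> carrier P \<Longrightarrow> y \<in> carrier P \<Longrightarrow> j x \<oplus>\<^bsub>transport j P\<^esub> j y = j (x \<oplus>\<^bsub>P\<^esub> y)"
  "x \<in> carrier P \<Longrightarrow> c \<odot>\<^bsub>transport j P\<^esub> j x = j (c \<odot>\<^bsub>P\<^esub> x)"
  "x \<in> carrier P \<Longrightarrow> vnorm (transport j P) (j x) = vnorm P x"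
  using inj_j by (simp_all add: transport_def Let_def)

lemma transport_normed: "complex_normed_space (transport j P)"
proof -
  have "abelian_group (transport j P)"
  proof (rule abelian_groupI)
    fix x assume "x \<in> carrier (transport j P)"
    then obtain p where p: "p \<in> carrier P" "x = j p" by auto
    show "\<exists>y\<in>carrier (transport j P). y \<oplus>\<^bsub>transport j P\<^esub> x = \<zero>\<^bsub>transport j P\<^esub>"
      by (rule bexI[of _ "j (\<ominus>\<^bsub>P\<^esub> p)"]) (use p in \<open>auto simp: P.M.l_neg\<close>)
  qed (auto simp: P.M.a_ac)
  moreover have "cring (ring_of_type_algebra :: complex ring)" ..
  ultimately have "module (ring_of_type_algebra :: complex ring) (transport j P)"
    by (intro moduleI)
      (auto simp: ring_of_type_algebra_def P.smult_add_left P.smult_add_right P.smult_smult P.smult_1)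
  then show ?thesis
  proof (rule complex_normed_space.intro, unfold_locales)
    fix x assume "x \<in> carrier (transport j P)"
    then obtain p where p: "p \<in> carrier P" "x = j p" by auto
    then show "0 \<le> vnorm (transport j P) x"
      by (simp add: P.vnorm_nonneg)
    show "vnorm (transport j P) x = 0 \<longleftrightarrow> x = \<zero>\<^bsub>transport j P\<^esub>"
      using p inj_j by (auto simp: P.vnorm_eq_zero_iff inj_on_eq_iff)
    show "vnorm (transport j P) (c \<odot>\<^bsub>transport j P\<^esub> x) = cmod c * vnorm (transport j P) x" for c
      using p by (simp add: P.vnorm_smult)
    fix y assume "y \<in> carrier (transport j P)"
    then show "vnorm (transport j P) (x \<oplus>\<^bsub>transport j P\<^esub> y) \<le>
        vnorm (transport j P) x + vnorm (transport j P) y"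
      using p by (auto simp: P.vnorm_triangle)
  qed
qed

lemma transport_linear: "linear_operator P (transport j P) j"
  by (auto simp: linear_operator_def)

lemma transport_banach: "complex_banach_space (transport j P)"
proof (rule complex_normed_space.complex_banach_spaceI[OF transport_normed])
  interpret J: linear_map P "transport j P" j
    by (intro linear_map.intro linear_map_axioms.intro transport_normed transport_linear
        P.complex_normed_space_axioms)
  have norm_diff: "vnorm (transport j P) (j p \<ominus>\<^bsub>transport j P\<^esub> j q) = vnorm P (p \<ominus>\<^bsub>P\<^esub> q)"
    if "p \<in> carrier P" "q \<in> carrier P" for p q
    using J.map_minus[OF that] that by (metis P.M.minus_closed transport_simps(5))
  fix u :: "nat \<Rightarrow> 'b"
  assume u: "\<And>n. u n \<in> carrier (transport j P)"
    and Cauchy_u: "\<And>e. 0 < e \<Longrightarrow>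
      \<exists>N. \<forall>m\<ge>N. \<forall>n\<ge>N. vnorm (transport j P) (u m \<ominus>\<^bsub>transport j P\<^esub> u n) < e"
  have "\<forall>n. \<exists>p. p \<in> carrier P \<and> u n = j p"
    using u by auto
  then obtain v where v: "\<And>n. v n \<in> carrier P" "\<And>n. u n = j (v n)"
    by metis
  obtain p where p: "p \<in> carrier P" "(\<lambda>n. vnorm P (v n \<ominus>\<^bsub>P\<^esub> p)) \<longlonglongrightarrow> 0"
  proof (rule P.Cauchy_converges[OF v(1)])
    show "\<exists>N. \<forall>m\<ge>N. \<forall>n\<ge>N. vnorm P (v m \<ominus>\<^bsub>P\<^esub> v n) < e" if "0 < e" for e
      using Cauchy_u[OF that] by (simp add: v norm_diff)
  qed
  then show "\<exists>x\<in>carrier (transport j P). (\<lambda>n. vnorm (transport j P) (u n \<ominus>\<^bsub>transport j P\<^esub> x)) \<longlonglongrightarrow> 0"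
    by (intro bexI[of _ "j p"]) (auto simp: v norm_diff)
qed

end

section \<open>The canonical quotient map and its section\<close>

text \<open>The canonical map from l1(S) to \<open>P\<close>, sending the unit vector at
  \<open>s\<close> to the point \<open>s\<close>. Whenever the sum converges,
  \<open>has_vsum_unique\<close> determines the value.\<close>

definition l1_sum :: "'a normed_module \<Rightarrow> 'a set \<Rightarrow> ('a \<Rightarrow> complex) \<Rightarrow> 'a" where
  "l1_sum P S f = (THE x. has_vsum P (\<lambda>s. f s \<odot>\<^bsub>P\<^esub> s) x S)"

context complex_banach_space
begin

text \<open>Points of \<open>S\<close> have norm at most 1, so the terms are dominated by
  \<open>cmod (f s)\<close>. This gives absolute convergence and the contraction estimate at
  once.\<close>

lemma
  assumes S: "S \<subseteq> closed_unit_ball E" and f: "f \<in> carrier (l1_space S)"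
  shows has_vsum_l1_sum: "has_vsum E (\<lambda>s. f s \<odot>\<^bsub>E\<^esub> s) (l1_sum E S f) S"
    and vnorm_l1_sum_le: "vnorm E (l1_sum E S f) \<le> vnorm (l1_space S) f"
proof -
  have S': "s \<in> carrier E" "vnorm E s \<le> 1" if "s \<in> S" for s
    using that S by (auto simp: closed_unit_ball_def)
  have closed: "(\<lambda>s. f s \<odot>\<^bsub>E\<^esub> s) \<in> S \<rightarrow> carrier E"
    using S' by simp
  have le: "vnorm E (f s \<odot>\<^bsub>E\<^esub> s) \<le> cmod (f s)" if "s \<in> S" for s
    using S'[OF that] by (simp add: vnorm_smult mult_left_le)
  have cmod_f: "(\<lambda>s. cmod (f s)) summable_on S"
    using f by simp
  have summ: "(\<lambda>s. vnorm E (f s \<odot>\<^bsub>E\<^esub> s)) summable_on S"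
    by (rule summable_on_comparison_test[OF cmod_f]) (use le S' vnorm_nonneg in auto)
  obtain x where x: "has_vsum E (\<lambda>s. f s \<odot>\<^bsub>E\<^esub> s) x S"
    using ex_has_vsum[OF closed summ] by blast
  have "l1_sum E S f = x"
    unfolding l1_sum_def
    by (rule the_equality[where P = "\<lambda>x. has_vsum E (\<lambda>s. f s \<odot>\<^bsub>E\<^esub> s) x S", OF x])
      (rule has_vsum_unique[OF closed _ x])
  then show *: "has_vsum E (\<lambda>s. f s \<odot>\<^bsub>E\<^esub> s) (l1_sum E S f) S"
    using x by simp
  have "vnorm E (l1_sum E S f) \<le> (\<Sum>\<^sub>\<infinity>s\<in>S. vnorm E (f s \<odot>\<^bsub>E\<^esub> s))"
    by (rule vnorm_has_vsum_le[OF closed * summ])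
  also have "\<dots> \<le> (\<Sum>\<^sub>\<infinity>s\<in>S. cmod (f s))"
    by (rule infsum_mono[OF summ cmod_f le])
  finally show "vnorm E (l1_sum E S f) \<le> vnorm (l1_space S) f"
    by simp
qed

lemma l1_sum_eqI:
  assumes S: "S \<subseteq> closed_unit_ball E" and f: "f \<in> carrier (l1_space S)"
    and x: "has_vsum E (\<lambda>s. f s \<odot>\<^bsub>E\<^esub> s) x S"
  shows "l1_sum E S f = x"
proof (rule has_vsum_unique[OF _ has_vsum_l1_sum[OF S f] x])
  show "(\<lambda>s. f s \<odot>\<^bsub>E\<^esub> s) \<in> S \<rightarrow> carrier E"
    using S by (auto simp: closed_unit_ball_def)
qed

lemma linear_l1_sum:
  assumes S: "S \<subseteq> closed_unit_ball E"
  shows "linear_operator (l1_space S) E (l1_sum E S)"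
proof -
  have closed: "(\<lambda>s. f s \<odot>\<^bsub>E\<^esub> s) \<in> S \<rightarrow> carrier E" for f
    using S by (auto simp: closed_unit_ball_def)
  interpret l1: complex_normed_space "l1_space S"
    by (rule l1_normed)
  show ?thesis
    unfolding linear_operator_def
  proof (intro conjI ballI allI)
    show "l1_sum E S \<in> carrier (l1_space S) \<rightarrow> carrier E"
      using has_vsum_l1_sum[OF S] by (auto simp: has_vsum_def)
    fix f assume f: "f \<in> carrier (l1_space S)"
    show "l1_sum E S (c \<odot>\<^bsub>l1_space S\<^esub> f) = c \<odot>\<^bsub>E\<^esub> l1_sum E S f" for c
    proof (rule l1_sum_eqI[OF S l1.smult_carrier[OF f]])
      have "has_vsum E (\<lambda>s. c \<odot>\<^bsub>E\<^esub> (f s \<odot>\<^bsub>E\<^esub> s)) (c \<odot>\<^bsub>E\<^esub> l1_sum E S f) S"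
        by (rule has_vsum_smult[OF closed has_vsum_l1_sum[OF S f]])
      moreover have *: "c \<odot>\<^bsub>E\<^esub> (f s \<odot>\<^bsub>E\<^esub> s) = (c * f s) \<odot>\<^bsub>E\<^esub> s" if "s \<in> S" for s
        using that S by (auto simp: closed_unit_ball_def smult_smult)
      moreover have "(\<lambda>s. c \<odot>\<^bsub>E\<^esub> (f s \<odot>\<^bsub>E\<^esub> s)) \<in> S \<rightarrow> carrier E"
        using funcset_mem[OF closed] by simp
      ultimately show "has_vsum E (\<lambda>s. (c \<odot>\<^bsub>l1_space S\<^esub> f) s \<odot>\<^bsub>E\<^esub> s) (c \<odot>\<^bsub>E\<^esub> l1_sum E S f) S"
        using has_vsum_cong[of S "\<lambda>s. c \<odot>\<^bsub>E\<^esub> (f s \<odot>\<^bsub>E\<^esub> s)" "\<lambda>s. (c * f s) \<odot>\<^bsub>E\<^esub> s", OF *]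
        by simp
    qed
    fix g assume g: "g \<in> carrier (l1_space S)"
    show "l1_sum E S (f \<oplus>\<^bsub>l1_space S\<^esub> g) = l1_sum E S f \<oplus>\<^bsub>E\<^esub> l1_sum E S g"
    proof (rule l1_sum_eqI[OF S l1.M.a_closed[OF f g]])
      have "has_vsum E (\<lambda>s. f s \<odot>\<^bsub>E\<^esub> s \<oplus>\<^bsub>E\<^esub> g s \<odot>\<^bsub>E\<^esub> s) (l1_sum E S f \<oplus>\<^bsub>E\<^esub> l1_sum E S g) S"
        by (rule has_vsum_add[OF closed closed has_vsum_l1_sum[OF S f] has_vsum_l1_sum[OF S g]])
      moreover have *: "f s \<odot>\<^bsub>E\<^esub> s \<oplus>\<^bsub>E\<^esub> g s \<odot>\<^bsub>E\<^esub> s = (f s + g s) \<odot>\<^bsub>E\<^esub> s" if "s \<in> S" for s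
        using that S by (auto simp: closed_unit_ball_def smult_add_left)
      moreover have "(\<lambda>s. f s \<odot>\<^bsub>E\<^esub> s \<oplus>\<^bsub>E\<^esub> g s \<odot>\<^bsub>E\<^esub> s) \<in> S \<rightarrow> carrier E"
        using funcset_mem[OF closed] by simp
      ultimately show "has_vsum E (\<lambda>s. (f \<oplus>\<^bsub>l1_space S\<^esub> g) s \<odot>\<^bsub>E\<^esub> s)
          (l1_sum E S f \<oplus>\<^bsub>E\<^esub> l1_sum E S g) S"
        using has_vsum_cong[of S "\<lambda>s. f s \<odot>\<^bsub>E\<^esub> s \<oplus>\<^bsub>E\<^esub> g s \<odot>\<^bsub>E\<^esub> s" "\<lambda>s. (f s + g s) \<odot>\<^bsub>E\<^esub> s", OF *]
        by simp
    qed
  qed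
qed

text \<open>Every point of \<open>S\<close> is the image of a vector in the closed unit ball. Taking
  the whole closed unit ball of \<open>E\<close> as \<open>S\<close> makes \<open>l1_sum E S\<close>
  strictly coisometric.\<close>

lemma l1_sum_unit:
  assumes S: "S \<subseteq> closed_unit_ball E" and "s \<in> S"
  shows "(\<lambda>t. if t = s then 1 else 0) \<in> closed_unit_ball (l1_space S)"
    and "l1_sum E S (\<lambda>t. if t = s then 1 else 0) = s"
proof -
  let ?e = "\<lambda>t. if t = s then 1 else (0 :: complex)"
  have SE: "S \<subseteq> carrier E"
    using S by (auto simp: closed_unit_ball_def)
  have "((\<lambda>t. cmod (?e t)) has_sum 1) S"
    by (rule has_sum_finite_neutralI[where B = "{s}"]) (use \<open>s \<in> S\<close> in auto)
  then have e: "?e \<in> carrier (l1_space S)" "vnorm (l1_space S) ?e = 1"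
    using \<open>s \<in> S\<close> by (auto simp: has_sum_iff)
  then show "?e \<in> closed_unit_ball (l1_space S)"
    by (simp add: closed_unit_ball_def)
  have "has_vsum E (\<lambda>t. ?e t \<odot>\<^bsub>E\<^esub> t) (?e s \<odot>\<^bsub>E\<^esub> s) S"
    by (rule has_vsum_single) (use \<open>s \<in> S\<close> SE in \<open>auto simp: smult_0 subset_iff\<close>)
  then have "has_vsum E (\<lambda>t. ?e t \<odot>\<^bsub>E\<^esub> t) s S"
    using \<open>s \<in> S\<close> SE by (auto simp: smult_1)
  then show "l1_sum E S ?e = s"
    by (rule l1_sum_eqI[OF S e(1)])
qed

end

text \<open>The identity of \<open>P\<close>, in the guise of the isometry \<open>j\<close> onto a
  copy, is lifted through the canonical map. The lifting keeps the operator norm, so it is a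
  contraction; the canonical map is a contraction as well and undoes it, hence the lifting is
  isometric.\<close>

lemma isometric_section:
  fixes P :: "'a normed_module"
  assumes "metrically_projective TYPE('a \<Rightarrow> complex) P"
  obtains \<psi> where "linear_operator P (l1_space (closed_unit_ball P)) \<psi>"
    "\<And>p. p \<in> carrier P \<Longrightarrow> l1_sum P (closed_unit_ball P) (\<psi> p) = p"
    "\<And>p. p \<in> carrier P \<Longrightarrow> vnorm (l1_space (closed_unit_ball P)) (\<psi> p) = vnorm P p"
proof -
  define S where "S = closed_unit_ball P"
  \<comment> \<open>The lifting property only covers targets with points in \<^typ>\<open>'a \<Rightarrow> complex\<close>, so \<open>P\<close> has to be copied there.\<close>
  define j :: "'a \<Rightarrow> 'a \<Rightarrow> complex" where "j p = (\<lambda>q. if q = p then 1 else 0)" for p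
  have banach: "complex_banach_space P"
    using assms by (simp add: metrically_projective_def)
  interpret P: complex_banach_space P by (rule banach)
  interpret l1: complex_normed_space "l1_space S" by (rule l1_normed)
  have "inj j"
    by (rule injI) (metis j_def zero_neq_one)
  then have inj: "inj_on j (carrier P)"
    by (rule inj_on_subset) simp
  note j_simps = transport_simps[OF banach inj]
  have SS: "S \<subseteq> closed_unit_ball P"
    by (simp add: S_def)
  note \<tau>_linear = linear_operatorD[OF P.linear_l1_sum[OF SS]]
  have "strictly_coisometric (l1_space S) (transport j P) (j \<circ> l1_sum P S)"
    unfolding strictly_coisometric_def
  proof
    show "linear_operator (l1_space S) (transport j P) (j \<circ> l1_sum P S)"
      unfolding linear_operator_def o_def
      using \<tau>_linear by (auto simp del: l1_simps simp: j_simps)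
    show "(j \<circ> l1_sum P S) ` closed_unit_ball (l1_space S) = closed_unit_ball (transport j P)"
    proof
      show "(j \<circ> l1_sum P S) ` closed_unit_ball (l1_space S) \<subseteq> closed_unit_ball (transport j P)"
        using P.vnorm_l1_sum_le[OF SS] \<tau>_linear(1)
        by (fastforce simp: closed_unit_ball_def j_simps simp del: l1_simps)
      show "closed_unit_ball (transport j P) \<subseteq> (j \<circ> l1_sum P S) ` closed_unit_ball (l1_space S)"
      proof
        fix x assume "x \<in> closed_unit_ball (transport j P)"
        then obtain p where p: "p \<in> S" "x = j p"
          by (auto simp: closed_unit_ball_def S_def j_simps)
        then show "x \<in> (j \<circ> l1_sum P S) ` closed_unit_ball (l1_space S)"
          using P.l1_sum_unit[OF SS p(1)] by (metis comp_apply imageI)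
      qed
    qed
  qed
  moreover have "bounded_operator P (transport j P) j"
    unfolding bounded_operator_def
    by (intro conjI transport_linear[OF banach inj] exI[of _ 1]) (simp add: j_simps)
  ultimately obtain \<psi> where \<psi>: "bounded_operator P (l1_space S) \<psi>"
    "\<forall>p\<in>carrier P. (j \<circ> l1_sum P S) (\<psi> p) = j p"
    "operator_norm P (l1_space S) \<psi> = operator_norm P (transport j P) j"
    using assms l1_banach[of S] transport_banach[OF banach inj]
    unfolding metrically_projective_def by blast
  have lin: "linear_operator P (l1_space S) \<psi>"
    using \<psi>(1) by (simp add: bounded_operator_def)
  have section_\<psi>: "l1_sum P S (\<psi> p) = p" if "p \<in> carrier P" for p
    using \<psi>(2) that \<open>inj j\<close> by (auto dest: injD)
  \<comment> \<open>The unit ball has to be nonempty for \<open>cSUP_least\<close> to bound the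
    supremum.\<close>
  have zero: "\<zero>\<^bsub>P\<^esub> \<in> S"
    by (simp add: S_def closed_unit_ball_def)
  have le1: "vnorm (l1_space S) (\<psi> p) \<le> 1" if "p \<in> S" for p
  proof -
    obtain K where K: "\<And>x. x \<in> carrier P \<Longrightarrow> vnorm (l1_space S) (\<psi> x) \<le> K * vnorm P x"
      using \<psi>(1) by (auto simp: bounded_operator_def)
    \<comment> \<open>Boundedness is what makes the supremum in \<open>operator_norm\<close> an
      upper bound. The sign of \<open>K\<close> is unknown, hence the passage to
      \<open>\<bar>K\<bar>\<close>.\<close>
    have "bdd_above ((\<lambda>x. vnorm (l1_space S) (\<psi> x)) ` closed_unit_ball P)"
    proof (rule bdd_aboveI2)
      fix x assume x: "x \<in> closed_unit_ball P"
      then have "vnorm (l1_space S) (\<psi> x) \<le> K * vnorm P x"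
        using K by (simp add: closed_unit_ball_def)
      also have "\<dots> \<le> \<bar>K\<bar> * vnorm P x"
        using x P.vnorm_nonneg by (intro mult_right_mono) (auto simp: closed_unit_ball_def)
      also have "\<dots> \<le> \<bar>K\<bar>"
        using x by (intro mult_left_le) (auto simp: closed_unit_ball_def)
      finally show "vnorm (l1_space S) (\<psi> x) \<le> \<bar>K\<bar>" .
    qed
    then have "vnorm (l1_space S) (\<psi> p) \<le> operator_norm P (l1_space S) \<psi>"
      unfolding operator_norm_def using that S_def by (intro cSUP_upper) auto
    also have "\<dots> = operator_norm P (transport j P) j"
      by (rule \<psi>(3))
    \<comment> \<open>Equality fails for the zero space, whose identity has norm 0; the upper bound
      suffices.\<close>
    also have "\<dots> \<le> 1"
      unfolding operator_norm_def
      using zero by (intro cSUP_least) (auto simp: S_def closed_unit_ball_def j_simps)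
    finally show ?thesis .
  qed
  have isometric: "vnorm (l1_space S) (\<psi> p) = vnorm P p" if p: "p \<in> carrier P" for p
  proof (rule antisym)
    have \<psi>p: "\<psi> p \<in> carrier (l1_space S)"
      by (rule linear_operatorD(1)[OF lin p])
    show "vnorm P p \<le> vnorm (l1_space S) (\<psi> p)"
      using P.vnorm_l1_sum_le[OF SS \<psi>p] section_\<psi>[OF p] by simp
    show "vnorm (l1_space S) (\<psi> p) \<le> vnorm P p"
    proof (cases "p = \<zero>\<^bsub>P\<^esub>")
      case True
      interpret linear_map P "l1_space S" \<psi>
        by (intro linear_map.intro linear_map_axioms.intro lin P.complex_normed_space_axioms l1_normed)
      show ?thesis
        using True map_zero by simp
    next
      case False
      then have pos: "0 < vnorm P p"
        using P.vnorm_nonneg[OF p] P.vnorm_eq_zero_iff[OF p] by simp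
      define c where "c = complex_of_real (inverse (vnorm P p))"
      have c: "cmod c = inverse (vnorm P p)"
        using pos by (simp add: c_def norm_inverse)
      then have "c \<odot>\<^bsub>P\<^esub> p \<in> S"
        using p pos by (simp add: S_def closed_unit_ball_def P.vnorm_smult)
      then have "vnorm (l1_space S) (\<psi> (c \<odot>\<^bsub>P\<^esub> p)) \<le> 1"
        by (rule le1)
      then have "inverse (vnorm P p) * vnorm (l1_space S) (\<psi> p) \<le> 1"
        by (simp only: linear_operatorD(3)[OF lin p] l1.vnorm_smult[OF \<psi>p] c)
      then show ?thesis
        using pos by (simp add: field_simps)
    qed
  qed
  show thesis
    using that[OF lin[unfolded S_def]] section_\<psi> isometric by (simp add: S_def)
qed

section \<open>The isometry onto the l1 space of the representatives\<close>

theorem proposition3p2: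
  fixes P :: "'a normed_module"
  assumes "metrically_projective TYPE('a \<Rightarrow> complex) P"
  shows "\<exists>M :: 'a set. isometrically_isomorphic P (l1_space M)"
proof -
  define S where "S = closed_unit_ball P"
  obtain \<psi> where lin: "linear_operator P (l1_space S) \<psi>"
    and section_\<psi>: "\<And>p. p \<in> carrier P \<Longrightarrow> l1_sum P S (\<psi> p) = p"
    and isometric: "\<And>p. p \<in> carrier P \<Longrightarrow> vnorm (l1_space S) (\<psi> p) = vnorm P p"
    using isometric_section[OF assms] unfolding S_def by blast
  interpret P: complex_banach_space P
    using assms by (simp add: metrically_projective_def)
  interpret \<psi>: linear_map P "l1_space S" \<psi>
    by (intro linear_map.intro linear_map_axioms.intro lin P.complex_normed_space_axioms l1_normed)
  have SS: "S \<subseteq> closed_unit_ball P"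
    by (simp add: S_def)
  have S: "s \<in> carrier P" "vnorm P s \<le> 1" if "s \<in> S" for s
    using that by (auto simp: S_def closed_unit_ball_def)
  \<comment> \<open>Applying \<open>\<psi>\<close> to the series that defines
    \<open>l1_sum P S g\<close> shows that the composite of \<open>l1_sum P S\<close> and
    \<open>\<psi>\<close> is the operator on l1(S) with matrix entries
    \<open>\<psi> t u\<close>.\<close>
  have expand: "((\<lambda>t. g t * \<psi> t u) has_sum \<psi> (l1_sum P S g) u) S" if g: "g \<in> carrier (l1_space S)" for g u
  proof -
    have closed: "(\<lambda>s. g s \<odot>\<^bsub>P\<^esub> s) \<in> S \<rightarrow> carrier P"
      using S by simp
    have "has_vsum (l1_space S) (\<lambda>s. \<psi> (g s \<odot>\<^bsub>P\<^esub> s)) (\<psi> (l1_sum P S g)) S"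
      by (rule \<psi>.map_has_vsum[where K = 1, OF _ closed P.has_vsum_l1_sum[OF SS g]])
        (simp del: l1_simps add: isometric)
    moreover have "(\<lambda>s. \<psi> (g s \<odot>\<^bsub>P\<^esub> s)) \<in> S \<rightarrow> carrier (l1_space S)"
      using closed \<psi>.linear_simps(1) by blast
    ultimately have "((\<lambda>s. \<psi> (g s \<odot>\<^bsub>P\<^esub> s) u) has_sum \<psi> (l1_sum P S g) u) S"
      by (intro l1_has_vsumD)
    also have "?this \<longleftrightarrow> ?thesis"
      using S by (intro has_sum_cong) (simp add: \<psi>.linear_simps(3))
    finally show ?thesis .
  qed
  \<comment> \<open>Since \<open>l1_sum P S\<close> undoes \<open>\<psi>\<close>, every
    \<open>\<psi> p\<close> is fixed by this matrix.\<close>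
  have \<psi>_fixed: "((\<lambda>t. \<psi> p t * \<psi> t u) has_sum \<psi> p u) S" if "p \<in> carrier P" for p u
    using expand[OF \<psi>.linear_simps(1)[OF that]] section_\<psi>[OF that] by simp
  have \<psi>_summable: "(\<lambda>u. cmod (\<psi> p u)) summable_on S" if "p \<in> carrier P" for p
    using \<psi>.linear_simps(1)[OF that] by simp
  interpret contractive_projection S \<psi>
  proof
    fix s assume s: "s \<in> S"
    show "(\<lambda>u. cmod (\<psi> s u)) summable_on S"
      by (rule \<psi>_summable[OF S(1)[OF s]])
    show "(\<Sum>\<^sub>\<infinity>u\<in>S. cmod (\<psi> s u)) \<le> 1"
      using isometric[OF S(1)[OF s]] S(2)[OF s] by simp
    show "((\<lambda>v. \<psi> s v * \<psi> v u) has_sum \<psi> s u) S" for u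
      by (rule \<psi>_fixed[OF S(1)[OF s]])
  qed
  have range_\<psi>: "in_range (\<psi> p)" if "p \<in> carrier P" for p
    using \<psi>_fixed[OF that] \<psi>_summable[OF that] by (simp add: in_range_def)
  \<comment> \<open>These are the coordinates of \<open>\<psi> p\<close> with respect to the rows of
    the representatives, as in \<open>has_sum_coordinates\<close>; the value 0 off
    \<open>reps\<close> is the convention of \<open>l1_space\<close>.\<close>
  define T where "T p = (\<lambda>m. if m \<in> reps then \<psi> p m / \<psi> m m else 0)" for p
  have T_sum: "((\<lambda>m. cmod (T p m)) has_sum vnorm P p) reps" if "p \<in> carrier P" for p
  proof -
    have "((\<lambda>m. cmod (T p m)) has_sum vnorm P p) reps \<longleftrightarrow>
        ((\<lambda>m. cmod (\<psi> p m / \<psi> m m)) has_sum vnorm P p) reps"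
      by (intro has_sum_cong) (simp add: T_def)
    then show ?thesis
      using has_sum_coordinates[OF range_\<psi>[OF that]] isometric[OF that] by simp
  qed
  have T_isometric: "vnorm (l1_space reps) (T p) = vnorm P p" if "p \<in> carrier P" for p
    using T_sum[OF that] by (simp add: infsumI)
  have T_linear: "linear_operator P (l1_space reps) T"
    unfolding linear_operator_def
  proof (intro conjI ballI allI)
    show "T \<in> carrier P \<rightarrow> carrier (l1_space reps)"
    proof
      fix p assume "p \<in> carrier P"
      then show "T p \<in> carrier (l1_space reps)"
        using has_sum_imp_summable[OF T_sum] by simp (simp add: T_def)
    qed
    show "T (p \<oplus>\<^bsub>P\<^esub> q) = T p \<oplus>\<^bsub>l1_space reps\<^esub> T q" if "p \<in> carrier P" "q \<in> carrier P" for p q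
      using that by (auto simp: T_def \<psi>.linear_simps add_divide_distrib)
    show "T (c \<odot>\<^bsub>P\<^esub> p) = c \<odot>\<^bsub>l1_space reps\<^esub> T p" if "p \<in> carrier P" for c p
      using that by (auto simp: T_def \<psi>.linear_simps)
  qed
  interpret T: linear_map P "l1_space reps" T
    by (intro linear_map.intro linear_map_axioms.intro T_linear P.complex_normed_space_axioms l1_normed)
  have "T ` carrier P = carrier (l1_space reps)"
  proof
    show "T ` carrier P \<subseteq> carrier (l1_space reps)"
      using T.linear_simps(1) by blast
    show "carrier (l1_space reps) \<subseteq> T ` carrier P"
    proof
      fix c assume c: "c \<in> carrier (l1_space reps)"
      \<comment> \<open>Vanishing off \<open>reps\<close>, \<open>c\<close> also belongs to l1(S),
        so that \<open>l1_sum P S c\<close> can serve as its preimage.\<close>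
      have "(\<lambda>m. cmod (c m)) summable_on reps \<longleftrightarrow> (\<lambda>m. cmod (c m)) summable_on S"
        using c reps_subset by (intro summable_on_cong_neutral) auto
      then have cS: "c \<in> carrier (l1_space S)"
        using c reps_subset by auto
      have "T (l1_sum P S c) m = c m" for m
      proof (cases "m \<in> reps")
        case True
        \<comment> \<open>Only \<open>t = m\<close> contributes: \<open>c t\<close> vanishes off
          \<open>reps\<close>, and \<open>\<psi> t m\<close> vanishes for the other representatives
          \<open>t\<close>.\<close>
        have "((\<lambda>t. c t * \<psi> t m) has_sum c m * \<psi> m m) S"
        proof (rule has_sum_finite_neutralI[where B = "{m}"])
          show "c t * \<psi> t m = 0" if "t \<in> S - {m}" for t
            using that c reps_off_diagonal[of t m] True by (cases "t \<in> reps") auto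
        qed (use True reps_subset in auto)
        then have "\<psi> (l1_sum P S c) m = c m * \<psi> m m"
          using expand[OF cS] has_sum_unique by blast
        then show ?thesis
          using True reps_diagonal_nonzero by (simp add: T_def)
      qed (use c in \<open>simp add: T_def\<close>)
      moreover have "l1_sum P S c \<in> carrier P"
        by (rule linear_operatorD(1)[OF P.linear_l1_sum[OF SS] cS])
      ultimately show "c \<in> T ` carrier P"
        by (intro image_eqI[of _ _ "l1_sum P S c"]) auto
    qed
  qed
  then have "bij_betw T (carrier P) (carrier (l1_space reps))"
    using T.isometry_imp_inj[OF T_isometric] by (simp add: bij_betw_def)
  then show ?thesis
    unfolding isometrically_isomorphic_def using T_linear T_isometric by blast
qed

end
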